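(* Let $\Gamma$ be a finite simplicial graph whose edges are labeled by even integers $\geq 2$, and let $G = G_{\Gamma}$ be the associated (even) Artin group. Suppose that every closed reduced path in $\Gamma$ all of whose edges have labels bigger than $2$ has odd length. Then for every $[\chi]\in S(G)$ we have $$[\chi]\in\Sigma^1(G) \quad\text{if and only if}\quad [\overline{\chi}]\in\Sigma^1(G/G''),$$ where $G''$ is the second derived subgroup of $G$ and $\overline{\chi}: G/G''\to\mathbb{R}$ is the character induced by $\chi$.
   Context: Artin groups. For a finite simplicial graph $\Gamma$ with vertex set $V(\Gamma)$ and edges labeled by integers $\geq 2$, the Artin group $G_\Gamma$ is generated by $V(\Gamma)$ with one relation $$\underbrace{uvu\cdots}_{n \text{ factors}}=\underbrace{vuv\cdots}_{n \text{ factors}}$$ for every edge of $\Gamma$ with vertices $u,v$ and label $n$. It is called even if all labels are even. Closed reduced paths. A closed reduced path in $\Gamma$ means a simple closed path (a cycle: at least three edges, with no vertex repeated except that the first and last vertices coincide); its length is its number of edges. Characters and $\Sigma^1$. For a finitely generated group $G$, $S(G)$ is the set of equivalence classes $[\chi]$ of non-zero homomorphisms (characters) $\chi: G\to\mathbb{R}$, where $\chi_1\sim\chi_2$ if and only if $\chi_1=r\chi_2$ for some real $r>0$. Put $G_\chi=\{g\in G\mid \chi(g)\ge 0\}$. Fix a finite generating set $Y$ of $G$ and the Cayley graph of $G$ with vertex set $G$ and edges joining $g$ to $gy$ ($g\in G$, $y\in Y$). Then $[\chi]\in\Sigma^1(G)$ if and only if the full subgraph of the Cayley graph spanned by the vertices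 in $G_\chi$ is connected (this does not depend on the choice of $Y$). *)

theory Defs
  imports Complex_Main "HOL-Algebra.Generated_Groups" "Graph_Theory.Digraph_Component"
begin

section \<open>Group presentations\<close>

text \<open>A letter \<open>(x, True)\<close> stands for the generator \<open>x\<close> and \<open>(x, False)\<close> for its formal inverse.\<close>

type_synonym 'a word = "('a \<times> bool) list"

definition words :: "'a set \<Rightarrow> 'a word set" where
  "words S = lists (S \<times> UNIV)"

inductive pres_eq :: "'a set \<Rightarrow> ('a word \<times> 'a word) set \<Rightarrow> 'a word \<Rightarrow> 'a word \<Rightarrow> bool"
  for S R where
  refl: "w \<in> words S \<Longrightarrow> pres_eq S R w w"
| sym: "pres_eq S R v w \<Longrightarrow> pres_eq S R w v"
| trans: "pres_eq S R u v \<Longrightarrow> pres_eq S R v w \<Longrightarrow> pres_eq S R u w"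
| cancel: "a \<in> words S \<Longrightarrow> b \<in> words S \<Longrightarrow> x \<in> S \<Longrightarrow>
    pres_eq S R (a @ [(x, e), (x, \<not> e)] @ b) (a @ b)"
| rel: "a \<in> words S \<Longrightarrow> b \<in> words S \<Longrightarrow> (r, s) \<in> R \<Longrightarrow>
    pres_eq S R (a @ r @ b) (a @ s @ b)"

definition pres_rel :: "'a set \<Rightarrow> ('a word \<times> 'a word) set \<Rightarrow> ('a word \<times> 'a word) set" where
  "pres_rel S R = {(v, w). pres_eq S R v w}"

text \<open>The group \<open>\<langle>S | r = s for (r, s) \<in> R\<rangle>\<close>; \<open>R\<close> is meant to consist of pairs of words over \<open>S\<close>.\<close>

definition presented_group :: "'a set \<Rightarrow> ('a word \<times> 'a word) set \<Rightarrow> 'a word set monoid" where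
  "presented_group S R =
    \<lparr>carrier = words S // pres_rel S R,
     monoid.mult = (\<lambda>A B. \<Union>a\<in>A. \<Union>b\<in>B. pres_rel S R `` {a @ b}),
     one = pres_rel S R `` {[]}\<rparr>"

lemma words_append [simp]: "a @ b \<in> words S \<longleftrightarrow> a \<in> words S \<and> b \<in> words S"
  by (auto simp: words_def)

lemma words_Nil [simp]: "[] \<in> words S"
  by (simp add: words_def)

lemma words_Cons [simp]: "(x, e) # w \<in> words S \<longleftrightarrow> x \<in> S \<and> w \<in> words S"
  by (auto simp: words_def)

lemma pres_eq_words:
  assumes "R \<subseteq> words S \<times> words S" "pres_eq S R v w"
  shows "v \<in> words S \<and> w \<in> words S"
  using assms(2,1) by induction auto

lemma equiv_pres_rel:
  assumes "R \<subseteq> words S \<times> words S"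
  shows "equiv (words S) (pres_rel S R)"
  using pres_eq_words[OF assms]
  by (intro equivI)
     (auto simp: pres_rel_def refl_on_def sym_def trans_def intro: pres_eq.intros)

lemma pres_eq_append_left:
  assumes "pres_eq S R v w" "c \<in> words S"
  shows "pres_eq S R (c @ v) (c @ w)"
  using assms
proof induction
  case (cancel a b x e)
  then show ?case using pres_eq.cancel[of "c @ a" S b x R e] by simp
next
  case (rel a b r s)
  then show ?case using pres_eq.rel[of "c @ a" S b r s R] by simp
qed (auto intro: pres_eq.intros)

lemma pres_eq_append_right:
  assumes "pres_eq S R v w" "c \<in> words S"
  shows "pres_eq S R (v @ c) (w @ c)"
  using assms
proof induction
  case (cancel a b x e)
  then show ?case using pres_eq.cancel[of a S "b @ c" x R e] by simp
next
  case (rel a b r s)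
  then show ?case using pres_eq.rel[of a S "b @ c" r s R] by simp
qed (auto intro: pres_eq.intros)

lemma presented_group_mult:
  assumes R: "R \<subseteq> words S \<times> words S" and "a \<in> words S" "b \<in> words S"
  shows "(pres_rel S R `` {a}) \<otimes>\<^bsub>presented_group S R\<^esub> (pres_rel S R `` {b}) = pres_rel S R `` {a @ b}"
proof -
  note eq = equiv_pres_rel[OF R]
  have "pres_rel S R `` {a' @ b'} = pres_rel S R `` {a @ b}"
    if "(a, a') \<in> pres_rel S R" "(b, b') \<in> pres_rel S R" for a' b'
  proof (rule equiv_class_eq[OF eq])
    have "pres_eq S R (a @ b) (a' @ b)" "pres_eq S R (a' @ b) (a' @ b')"
      using that pres_eq_words[OF R] assms
      by (auto simp: pres_rel_def intro: pres_eq_append_left pres_eq_append_right)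
    then show "(a' @ b', a @ b) \<in> pres_rel S R"
      by (auto simp: pres_rel_def intro: pres_eq.intros)
  qed
  moreover have "a \<in> pres_rel S R `` {a}" "b \<in> pres_rel S R `` {b}"
    using assms by (auto simp: pres_rel_def intro: pres_eq.refl)
  ultimately show ?thesis
    unfolding presented_group_def by (auto simp del: Image_singleton_iff)
qed

lemma pres_eq_inverse:
  assumes "w \<in> words S"
  shows "pres_eq S R (rev (map (\<lambda>(x, e). (x, \<not> e)) w) @ w) []"
  using assms
proof (induction w)
  case Nil
  then show ?case by (auto intro: pres_eq.refl)
next
  case (Cons l w)
  obtain x e where l: "l = (x, e)" by (cases l)
  have inv_words: "rev (map (\<lambda>(x, e). (x, \<not> e)) w) \<in> words S"
    using Cons.prems by (auto simp: words_def l)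
  have "pres_eq S R (rev (map (\<lambda>(x, e). (x, \<not> e)) w) @ [(x, \<not> e), (x, \<not> \<not> e)] @ w)
          (rev (map (\<lambda>(x, e). (x, \<not> e)) w) @ w)"
    using Cons.prems inv_words by (intro pres_eq.cancel) (auto simp: l)
  with Cons show ?case by (auto simp: l intro: pres_eq.trans)
qed

lemma group_presented_group:
  assumes R: "R \<subseteq> words S \<times> words S"
  shows "group (presented_group S R)"
proof (rule groupI)
  let ?G = "presented_group S R" and ?c = "\<lambda>w. pres_rel S R `` {w}"
  have car: "carrier ?G = ?c ` words S"
    by (auto simp: presented_group_def quotient_def)
  have one: "\<one>\<^bsub>?G\<^esub> = ?c []"
    by (simp add: presented_group_def)
  note m = presented_group_mult[OF R]
  show "\<one>\<^bsub>?G\<^esub> \<in> carrier ?G"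
    by (auto simp: car one)
  show "\<And>x y. x \<in> carrier ?G \<Longrightarrow> y \<in> carrier ?G \<Longrightarrow> x \<otimes>\<^bsub>?G\<^esub> y \<in> carrier ?G"
    by (auto simp: car m)
  show "\<And>x y z. x \<in> carrier ?G \<Longrightarrow> y \<in> carrier ?G \<Longrightarrow> z \<in> carrier ?G \<Longrightarrow>
      x \<otimes>\<^bsub>?G\<^esub> y \<otimes>\<^bsub>?G\<^esub> z = x \<otimes>\<^bsub>?G\<^esub> (y \<otimes>\<^bsub>?G\<^esub> z)"
    by (auto simp: car m)
  show "\<And>x. x \<in> carrier ?G \<Longrightarrow> \<one>\<^bsub>?G\<^esub> \<otimes>\<^bsub>?G\<^esub> x = x"
    by (auto simp: car one m)
  fix X assume "X \<in> carrier ?G"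
  then obtain w where w: "w \<in> words S" "X = ?c w" by (auto simp: car)
  let ?w' = "rev (map (\<lambda>(x, e). (x, \<not> e)) w)"
  have w': "?w' \<in> words S" using w by (auto simp: words_def)
  have "?c (?w' @ w) = ?c []"
    using pres_eq_inverse[OF w(1)]
    by (intro equiv_class_eq[OF equiv_pres_rel[OF R]]) (simp add: pres_rel_def)
  then have "?c ?w' \<otimes>\<^bsub>?G\<^esub> X = \<one>\<^bsub>?G\<^esub>"
    by (simp add: w one m w')
  then show "\<exists>Y\<in>carrier ?G. Y \<otimes>\<^bsub>?G\<^esub> X = \<one>\<^bsub>?G\<^esub>"
    using w' car by blast
qed

section \<open>Artin groups\<close>

text \<open>A finite simplicial graph is a finite loop-free symmetric digraph \<open>\<Gamma>\<close>, \<^term>\<open>pair_graph \<Gamma>\<close>.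
  An edge joining \<open>u\<close> and \<open>v\<close> is represented by both arcs \<open>(u, v)\<close> and \<open>(v, u)\<close>, and its label
  is \<open>m {u, v}\<close>.\<close>

definition alt_word :: "'v \<Rightarrow> 'v \<Rightarrow> nat \<Rightarrow> 'v word" where
  "alt_word u v n = map (\<lambda>i. (if even i then u else v, True)) [0..<n]"

definition artin_group :: "'v pair_pre_digraph \<Rightarrow> ('v set \<Rightarrow> nat) \<Rightarrow> 'v word set monoid" where
  "artin_group \<Gamma> m = presented_group (pverts \<Gamma>)
     {(alt_word u v (m {u, v}), alt_word v u (m {u, v})) | u v. (u, v) \<in> parcs \<Gamma>}"

lemma group_artin_group:
  assumes "pair_graph \<Gamma>"
  shows "group (artin_group \<Gamma> m)"
proof -
  interpret pair_graph \<Gamma> by (rule assms)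
  have "alt_word u v n \<in> words (pverts \<Gamma>)" "alt_word v u n \<in> words (pverts \<Gamma>)"
    if "(u, v) \<in> parcs \<Gamma>" for u v n
    using in_arcsD1[OF that] in_arcsD2[OF that] by (auto simp: alt_word_def words_def)
  then show ?thesis
    unfolding artin_group_def by (intro group_presented_group) blast
qed

text \<open>In a symmetric digraph \<^const>\<open>pre_digraph.cycle\<close> also allows going back and forth along
  a single edge; the bound on the length excludes this.\<close>

definition closed_reduced_path :: "'v pair_pre_digraph \<Rightarrow> ('v \<times> 'v) list \<Rightarrow> bool" where
  "closed_reduced_path \<Gamma> p \<longleftrightarrow> pre_digraph.cycle (with_proj \<Gamma>) p \<and> length p \<ge> 3"

section \<open>Characters and the invariant \<open>\<Sigma>\<^sup>1\<close>\<close>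

definition real_group :: "real monoid" where
  "real_group = \<lparr>carrier = UNIV, monoid.mult = (+), one = 0\<rparr>"

definition nonzero_characters :: "('a, 'b) monoid_scheme \<Rightarrow> ('a \<Rightarrow> real) set" where
  "nonzero_characters G = {\<chi> \<in> hom G real_group. \<exists>g\<in>carrier G. \<chi> g \<noteq> 0}"

definition character_rel :: "('a, 'b) monoid_scheme \<Rightarrow> (('a \<Rightarrow> real) \<times> ('a \<Rightarrow> real)) set" where
  "character_rel G = {(\<chi>1, \<chi>2). \<chi>1 \<in> nonzero_characters G \<and> \<chi>2 \<in> nonzero_characters G \<and>
     (\<exists>r>0. \<forall>g\<in>carrier G. \<chi>1 g = r * \<chi>2 g)}"

definition character_class :: "('a, 'b) monoid_scheme \<Rightarrow> ('a \<Rightarrow> real) \<Rightarrow> ('a \<Rightarrow> real) set" where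
  "character_class G \<chi> = character_rel G `` {\<chi>}"

definition character_sphere :: "('a, 'b) monoid_scheme \<Rightarrow> ('a \<Rightarrow> real) set set" where
  "character_sphere G = nonzero_characters G // character_rel G"

definition cayley_graph :: "('a, 'b) monoid_scheme \<Rightarrow> 'a set \<Rightarrow> ('a, 'a \<times> 'a) pre_digraph" where
  "cayley_graph G Y =
    \<lparr>verts = carrier G, arcs = carrier G \<times> Y, tail = fst, head = (\<lambda>(g, y). g \<otimes>\<^bsub>G\<^esub> y)\<rparr>"

text \<open>\<^const>\<open>connected\<close> is connectedness of the underlying undirected graph. The choice of the
  finite generating set \<open>Y\<close> is immaterial, so asking for some \<open>Y\<close> amounts to fixing any one.\<close>

definition Sigma1 :: "('a, 'b) monoid_scheme \<Rightarrow> ('a \<Rightarrow> real) set set" where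
  "Sigma1 G = {c \<in> character_sphere G. \<exists>\<chi>\<in>c. \<exists>Y. finite Y \<and> Y \<subseteq> carrier G \<and>
     generate G Y = carrier G \<and>
     connected (cayley_graph G Y \<restriction> {g \<in> carrier G. \<chi> g \<ge> 0})}"

definition second_derived :: "('a, 'b) monoid_scheme \<Rightarrow> 'a set" where
  "second_derived G = derived G (derived G (carrier G))"

text \<open>For \<open>\<chi>\<close> constant on each coset, in particular for a character trivial on the normal
  subgroup, this is the induced map on cosets.\<close>

definition induced_map :: "('a \<Rightarrow> 'c) \<Rightarrow> 'a set \<Rightarrow> 'c" where
  "induced_map \<chi> = (\<lambda>C. the_elem (\<chi> ` C))"

lemma group_real_group: "group real_group"
  unfolding real_group_def
  by (rule groupI) (auto intro: exI[of _ "- _"])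

lemma induced_map_second_derived:
  assumes "group G" "\<chi> \<in> hom G real_group" "g \<in> carrier G"
  shows "induced_map \<chi> (second_derived G #>\<^bsub>G\<^esub> g) = \<chi> g"
proof -
  interpret group_hom G real_group \<chi>
    using assms group_real_group by (simp add: group_hom_def group_hom_axioms_def)
  have mult: "\<chi> (x \<otimes>\<^bsub>G\<^esub> y) = \<chi> x + \<chi> y" if "x \<in> carrier G" "y \<in> carrier G" for x y
    using hom_mult[OF that] by (simp add: real_group_def)
  have one: "\<chi> \<one>\<^bsub>G\<^esub> = 0"
    using hom_one by (simp add: real_group_def)
  have inv: "\<chi> (inv\<^bsub>G\<^esub> x) = - \<chi> x" if "x \<in> carrier G" for x
    using mult[of x "inv\<^bsub>G\<^esub> x"] that one by simp
  have "derived_set G (carrier G) \<subseteq> kernel G real_group \<chi>"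
    by (auto simp: kernel_def mult inv real_group_def simp del: hom_mult hom_inv)
  then have D1: "derived G (carrier G) \<subseteq> kernel G real_group \<chi>"
    unfolding derived_def by (rule G.generate_subgroup_incl) (rule subgroup_kernel)
  have D2: "second_derived G \<subseteq> kernel G real_group \<chi>"
    unfolding second_derived_def
    using D1 subgroup_kernel G.derived_incl by blast
  have "subgroup (second_derived G) G"
    unfolding second_derived_def by (intro G.derived_is_subgroup G.derived_in_carrier) auto
  then have "\<one>\<^bsub>G\<^esub> \<in> second_derived G"
    by (rule subgroup.one_closed)
  moreover have "\<chi> (h \<otimes>\<^bsub>G\<^esub> g) = \<chi> g" if "h \<in> second_derived G" for h
    using that D2 assms(3) mult[of h g] by (auto simp: kernel_def real_group_def)
  ultimately have "\<chi> ` (second_derived G #>\<^bsub>G\<^esub> g) = {\<chi> g}"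
    by (auto simp: r_coset_def image_iff simp del: hom_mult intro!: bexI[of _ "\<one>\<^bsub>G\<^esub>"])
  then show ?thesis
    by (simp add: induced_map_def)
qed

end

theory Submission
  imports Defs
begin

text \<open>Call a vertex \<open>v\<close> live if \<open>\<chi> v \<noteq> 0\<close>, and an edge joining live vertices \<open>u, v\<close> dead if its label
  exceeds \<open>2\<close> and \<open>\<chi> u + \<chi> v = 0\<close>. Both \<open>[\<chi>] \<in> \<Sigma>\<^sup>1(G)\<close> and \<open>[\<chi>] \<in> \<Sigma>\<^sup>1(G/G'')\<close> (for the induced character)
  turn out to mean that the graph of live vertices and non-dead edges is connected and that every
  other vertex of \<open>\<Gamma>\<close> is adjacent to a live one.

  If this condition holds, rays \<open>g, g x, g x\<^sup>2, \<dots>\<close> with \<open>\<chi> x > 0\<close> all have the same end, because an edge with label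
  \<open>2 n\<close> provides the element \<open>(u v)\<^sup>n\<close> commuting with both \<open>u\<close> and \<open>v\<close>; this gives \<open>[\<chi>] \<in> \<Sigma>\<^sup>1(G)\<close>.

  If it fails, \<open>G\<close> acts non-abelianly by affine maps with linear parts \<open>\<theta>(g) \<tau>\<^sup>\<chi>\<^sup>(\<^sup>g\<^sup>)\<close> on the functions
  \<open>\<real> \<rightarrow> \<complex>\<close> with support bounded below, \<open>\<tau>\<^sup>r\<close> being translation by \<open>r\<close>. Such an action factors through \<open>G/G''\<close> and excludes
  \<open>[\<chi>]\<close> from \<open>\<Sigma>\<^sup>1(G/G'')\<close>. When the live graph is disconnected, the generators in one component get a
  different fixed point from the others; a dead edge with label \<open>2 n\<close> between components is
  compatible with this if \<open>\<theta>(u) \<theta>(v) \<noteq> 1\<close> is an \<open>n\<close>-th root of unity. As \<open>\<chi>\<close> changes sign along dead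
  edges, a cycle of dead edges would have even length, so by hypothesis they form a forest and \<open>\<theta>\<close> can be
  chosen edge by edge.\<close>

section \<open>Connectedness above a level\<close>

text \<open>The level \<open>r\<close> is free because left translation by \<open>k\<close> shifts
  levels by \<open>\<chi> k\<close>, and ends of rays involve all levels. Arcs go both ways since
  connectedness is undirected.\<close>

definition upper_arcs ::
    "('a, 'b) monoid_scheme \<Rightarrow> ('a \<Rightarrow> real) \<Rightarrow> 'a set \<Rightarrow> real \<Rightarrow> ('a \<times> 'a) set" where
  "upper_arcs G \<chi> Y r = {(g, h). g \<in> carrier G \<and> h \<in> carrier G \<and> r \<le> \<chi> g \<and> r \<le> \<chi> h \<and>
     (\<exists>y\<in>Y. h = g \<otimes>\<^bsub>G\<^esub> y \<or> g = h \<otimes>\<^bsub>G\<^esub> y)}"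

text \<open>\<open>rtrancl\<close> is reflexive everywhere; the conditions on \<open>g\<close>
  confine the trivial path to vertices above the level.\<close>

definition linked ::
    "('a, 'b) monoid_scheme \<Rightarrow> ('a \<Rightarrow> real) \<Rightarrow> 'a set \<Rightarrow> real \<Rightarrow> 'a \<Rightarrow> 'a \<Rightarrow> bool" where
  "linked G \<chi> Y r g h \<longleftrightarrow> g \<in> carrier G \<and> r \<le> \<chi> g \<and> (g, h) \<in> (upper_arcs G \<chi> Y r)\<^sup>*"

lemma linked_refl: "g \<in> carrier G \<Longrightarrow> r \<le> \<chi> g \<Longrightarrow> linked G \<chi> Y r g g"
  by (simp add: linked_def)

lemma linked_closed:
  assumes "linked G \<chi> Y r g h"
  shows "g \<in> carrier G" "h \<in> carrier G" "r \<le> \<chi> g" "r \<le> \<chi> h"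
proof -
  have "(g, h) \<in> (upper_arcs G \<chi> Y r)\<^sup>*" using assms by (simp add: linked_def)
  then have "h = g \<or> h \<in> carrier G \<and> r \<le> \<chi> h"
    by (cases rule: rtranclE) (auto simp: upper_arcs_def)
  then show "g \<in> carrier G" "h \<in> carrier G" "r \<le> \<chi> g" "r \<le> \<chi> h"
    using assms by (auto simp: linked_def)
qed

lemma sym_upper_arcs: "sym (upper_arcs G \<chi> Y r)"
  by (auto simp: upper_arcs_def sym_def)

lemma linked_sym:
  assumes "linked G \<chi> Y r g h"
  shows "linked G \<chi> Y r h g"
  using assms linked_closed[OF assms] sym_rtrancl[OF sym_upper_arcs, of G \<chi> Y r]
  by (auto simp: linked_def dest: symD)

lemma linked_trans: "linked G \<chi> Y r g h \<Longrightarrow> linked G \<chi> Y r h k \<Longrightarrow> linked G \<chi> Y r g k"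
  by (auto simp: linked_def)

lemma linked_mono:
  assumes "linked G \<chi> Y r g h" "s \<le> r"
  shows "linked G \<chi> Y s g h"
proof -
  have "upper_arcs G \<chi> Y r \<subseteq> upper_arcs G \<chi> Y s"
    using assms(2) by (auto simp: upper_arcs_def)
  from rtrancl_mono[OF this] show ?thesis
    using assms by (auto simp: linked_def)
qed

lemma linked_induct [consumes 1, case_names refl step]:
  assumes "linked G \<chi> Y r g h"
    and "P g"
    and "\<And>x y. linked G \<chi> Y r g x \<Longrightarrow> (x, y) \<in> upper_arcs G \<chi> Y r \<Longrightarrow> P x \<Longrightarrow> P y"
  shows "P h"
proof -
  have "(g, h) \<in> (upper_arcs G \<chi> Y r)\<^sup>*" using assms(1) by (simp add: linked_def)
  then show ?thesis
  proof (induction rule: rtrancl_induct)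
    case base
    show ?case by fact
  next
    case (step x y)
    have "linked G \<chi> Y r g x" using step(1) assms(1) by (simp add: linked_def)
    then show ?case using step assms(3) by blast
  qed
qed

lemma linked_arc: "(g, h) \<in> upper_arcs G \<chi> Y r \<Longrightarrow> linked G \<chi> Y r g h"
  by (auto simp: linked_def upper_arcs_def)

lemma connected_cayley_graph_iff:
  assumes "group G" "\<chi> \<one>\<^bsub>G\<^esub> = 0"
  shows "connected (cayley_graph G Y \<restriction> {g \<in> carrier G. \<chi> g \<ge> 0}) \<longleftrightarrow>
    (\<forall>g\<in>carrier G. \<chi> g \<ge> 0 \<longrightarrow> linked G \<chi> Y 0 \<one>\<^bsub>G\<^esub> g)"
proof -
  interpret group G by fact
  let ?V = "{g \<in> carrier G. \<chi> g \<ge> 0}" and ?A = "upper_arcs G \<chi> Y 0"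
  let ?C = "cayley_graph G Y \<restriction> ?V"
  have A: "parcs (mk_symmetric ?C) = ?A"
    by (auto simp: parcs_mk_symmetric cayley_graph_def upper_arcs_def)
  have reach: "g \<rightarrow>\<^sup>*\<^bsub>mk_symmetric ?C\<^esub> h \<longleftrightarrow> linked G \<chi> Y 0 g h"
    if "g \<in> ?V" "h \<in> ?V" for g h
  proof
    assume "g \<rightarrow>\<^sup>*\<^bsub>mk_symmetric ?C\<^esub> h"
    then show "linked G \<chi> Y 0 g h"
      using that by (auto simp: reachable_def A linked_def dest: rtrancl_on_rtranclI)
  next
    assume "linked G \<chi> Y 0 g h"
    then show "g \<rightarrow>\<^sup>*\<^bsub>mk_symmetric ?C\<^esub> h"
      unfolding reachable_def with_proj_simps A
      by (intro rtrancl_consistent_rtrancl_on)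
         (use that in \<open>auto simp: linked_def upper_arcs_def\<close>)
  qed
  have "\<one>\<^bsub>G\<^esub> \<in> ?V" using assms by simp
  then have "connected ?C \<longleftrightarrow> (\<forall>g\<in>?V. \<forall>h\<in>?V. linked G \<chi> Y 0 g h)"
    unfolding connected_def strongly_connected_def
    using reach by auto
  also have "\<dots> \<longleftrightarrow> (\<forall>g\<in>?V. linked G \<chi> Y 0 \<one>\<^bsub>G\<^esub> g)"
    using \<open>\<one>\<^bsub>G\<^esub> \<in> ?V\<close> linked_sym linked_trans by meson
  finally show ?thesis by blast
qed

section \<open>Characters and translation of paths\<close>

locale character = group G for G (structure) +
  fixes \<chi> :: "'a \<Rightarrow> real"
  assumes character: "\<chi> \<in> hom G real_group"
begin

lemma char_mult [simp]: "x \<in> carrier G \<Longrightarrow> y \<in> carrier G \<Longrightarrow> \<chi> (x \<otimes> y) = \<chi> x + \<chi> y"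
  using character by (auto simp: hom_def real_group_def)

lemma char_one [simp]: "\<chi> \<one> = 0"
  using char_mult[of \<one> \<one>] by simp

lemma char_inv [simp]: "x \<in> carrier G \<Longrightarrow> \<chi> (inv x) = - \<chi> x"
  using char_mult[of x "inv x"] by simp

lemma char_pow [simp]: "x \<in> carrier G \<Longrightarrow> \<chi> (x [^] (n::nat)) = real n * \<chi> x"
  by (induction n) (auto simp: algebra_simps)

text \<open>Left multiplication by \<open>k\<close> is an automorphism of the Cayley graph and adds
  \<open>\<chi> k\<close> to every level.\<close>

lemma linked_shift:
  assumes "linked G \<chi> Y r g h" "k \<in> carrier G" "Y \<subseteq> carrier G"
  shows "linked G \<chi> Y (\<chi> k + r) (k \<otimes> g) (k \<otimes> h)"
  using assms(1)
proof (induction rule: linked_induct)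
  case refl
  show ?case using linked_closed[OF assms(1)] assms(2) by (intro linked_refl) auto
next
  case (step x y)
  have "(k \<otimes> x, k \<otimes> y) \<in> upper_arcs G \<chi> Y (\<chi> k + r)"
    using step(2) assms(2,3) by (auto simp: upper_arcs_def m_assoc subset_iff)
  with step(3) show ?case by (blast intro: linked_trans linked_arc)
qed

lemma linked_shift':
  assumes "linked G \<chi> Y r \<one> h" "k \<in> carrier G" "Y \<subseteq> carrier G" "s \<le> \<chi> k + r"
  shows "linked G \<chi> Y s k (k \<otimes> h)"
  using linked_mono[OF linked_shift[OF assms(1-3)] assms(4)] assms(2) by simp

text \<open>A word in \<open>Y\<close> spelling \<open>x\<close> traces a finite path from the
  identity, and finitely many values are bounded below.\<close>

lemma linked_generate:
  assumes "Y \<subseteq> carrier G" "x \<in> generate G Y"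
  shows "\<exists>r. linked G \<chi> Y r \<one> x"
  using assms(2)
proof induction
  case one
  then show ?case by (auto intro!: exI[of _ 0] linked_refl)
next
  case (incl y)
  then have "(\<one>, y) \<in> upper_arcs G \<chi> Y (min 0 (\<chi> y))"
    using assms(1) by (auto simp: upper_arcs_def intro!: bexI[of _ y])
  then show ?case by (blast intro: linked_arc)
next
  case (inv y)
  then have "(\<one>, inv y) \<in> upper_arcs G \<chi> Y (min 0 (- \<chi> y))"
    using assms(1) by (auto simp: upper_arcs_def intro!: bexI[of _ y])
  then show ?case by (blast intro: linked_arc)
next
  case (eng x y)
  then obtain r s where rs: "linked G \<chi> Y r \<one> x" "linked G \<chi> Y s \<one> y" by blast
  have "x \<in> carrier G" using linked_closed[OF rs(1)] by simp
  then have "linked G \<chi> Y (min r (\<chi> x + s)) x (x \<otimes> y)"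
    using rs(2) assms(1) by (intro linked_shift') auto
  with rs(1) show ?case by (meson linked_mono linked_trans min.cobounded1)
qed

text \<open>The path to \<open>x\<close> is repeated from each power of \<open>x\<close>; these have
  nonnegative value, so no translate dips below \<open>r\<close>.\<close>

lemma linked_pow:
  assumes "linked G \<chi> Y r \<one> x" "Y \<subseteq> carrier G" "0 \<le> \<chi> x"
  shows "linked G \<chi> Y r \<one> (x [^] (n::nat))"
proof (induction n)
  case 0
  then show ?case using linked_closed[OF assms(1)] by (auto intro: linked_refl)
next
  case (Suc n)
  have x: "x \<in> carrier G" using linked_closed[OF assms(1)] by simp
  then have "linked G \<chi> Y r (x [^] n) (x [^] n \<otimes> x)"
    using assms by (intro linked_shift'[OF assms(1)]) auto
  with Suc show ?case by (auto intro: linked_trans)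
qed

end

text \<open>Positive multiples of \<open>\<chi>\<close> have the same upper half, so any
  representative of the class decides.\<close>

lemma character_class_in_Sigma1_iff:
  assumes "group G" "\<chi> \<in> nonzero_characters G"
  shows "character_class G \<chi> \<in> Sigma1 G \<longleftrightarrow>
    (\<exists>Y. finite Y \<and> Y \<subseteq> carrier G \<and> generate G Y = carrier G \<and>
      (\<forall>g\<in>carrier G. \<chi> g \<ge> 0 \<longrightarrow> linked G \<chi> Y 0 \<one>\<^bsub>G\<^esub> g))" (is "_ \<longleftrightarrow> ?R")
proof -
  interpret group G by fact
  interpret character G \<chi>
    using assms by unfold_locales (auto simp: nonzero_characters_def)
  have conn: "connected (cayley_graph G Y \<restriction> {g \<in> carrier G. \<psi> g \<ge> 0}) \<longleftrightarrow>
      (\<forall>g\<in>carrier G. \<chi> g \<ge> 0 \<longrightarrow> linked G \<chi> Y 0 \<one>\<^bsub>G\<^esub> g)"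
    if "\<psi> \<in> character_class G \<chi>" for \<psi> Y
  proof -
    from that obtain r where "r > 0" "\<forall>g\<in>carrier G. \<chi> g = r * \<psi> g"
      by (auto simp: character_class_def character_rel_def)
    then have "{g \<in> carrier G. \<psi> g \<ge> 0} = {g \<in> carrier G. \<chi> g \<ge> 0}"
      by (auto simp: zero_le_mult_iff)
    then show ?thesis
      using connected_cayley_graph_iff[of G \<chi> Y] assms(1) char_one by simp
  qed
  have cls: "\<chi> \<in> character_class G \<chi>"
    using assms by (auto simp: character_class_def character_rel_def intro!: exI[of _ 1])
  have sph: "character_class G \<chi> \<in> character_sphere G"
    using assms by (auto simp: character_sphere_def character_class_def quotient_def)
  show ?thesis
  proof
    assume "character_class G \<chi> \<in> Sigma1 G"
    then obtain \<psi> Y where "\<psi> \<in> character_class G \<chi>" "finite Y" "Y \<subseteq> carrier G"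
        "generate G Y = carrier G" "connected (cayley_graph G Y \<restriction> {g \<in> carrier G. \<psi> g \<ge> 0})"
      unfolding Sigma1_def by blast
    then show ?R using conn by (intro exI[of _ Y]) simp
  next
    assume ?R
    then obtain Y where Y: "finite Y" "Y \<subseteq> carrier G" "generate G Y = carrier G"
        "\<forall>g\<in>carrier G. \<chi> g \<ge> 0 \<longrightarrow> linked G \<chi> Y 0 \<one>\<^bsub>G\<^esub> g"
      by blast
    then have "connected (cayley_graph G Y \<restriction> {g \<in> carrier G. \<chi> g \<ge> 0})"
      using conn[OF cls] by simp
    with Y(1-3) cls sph show "character_class G \<chi> \<in> Sigma1 G"
      unfolding Sigma1_def by blast
  qed
qed

section \<open>Ends of ascending rays\<close>

context character
begin

text \<open>The two rays have the same end. Letting both indices vary independently makes this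
  transitive and forces both rays to rise above every level eventually.\<close>

definition rays_equiv :: "'a set \<Rightarrow> 'a \<Rightarrow> 'a \<Rightarrow> 'a \<Rightarrow> 'a \<Rightarrow> bool" where
  "rays_equiv Y g x h y \<longleftrightarrow>
    (\<forall>r. \<exists>N::nat. \<forall>n\<ge>N. \<forall>m\<ge>N::nat. linked G \<chi> Y r (g \<otimes> x [^] (n::nat)) (h \<otimes> y [^] (m::nat)))"

lemma rays_equivE:
  assumes "rays_equiv Y g x h y"
  obtains N where "\<And>(n::nat) m::nat. n \<ge> N \<Longrightarrow> m \<ge> N \<Longrightarrow>
    linked G \<chi> Y r (g \<otimes> x [^] (n::nat)) (h \<otimes> y [^] (m::nat))"
  using assms unfolding rays_equiv_def by blast

lemma rays_equiv_sym: "rays_equiv Y g x h y \<Longrightarrow> rays_equiv Y h y g x"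
  unfolding rays_equiv_def by (blast intro: linked_sym)

lemma rays_equiv_trans:
  assumes "rays_equiv Y g x h y" "rays_equiv Y h y k z"
  shows "rays_equiv Y g x k z"
  unfolding rays_equiv_def
proof
  fix r
  obtain M where
      M: "\<And>(n::nat) m::nat. n \<ge> M \<Longrightarrow> m \<ge> M \<Longrightarrow> linked G \<chi> Y r (g \<otimes> x [^] n) (h \<otimes> y [^] m)"
    using assms(1) by (rule rays_equivE[where r = r]) blast
  obtain N where
      N: "\<And>(n::nat) m::nat. n \<ge> N \<Longrightarrow> m \<ge> N \<Longrightarrow> linked G \<chi> Y r (h \<otimes> y [^] n) (k \<otimes> z [^] m)"
    using assms(2) by (rule rays_equivE[where r = r]) blast
  have "linked G \<chi> Y r (g \<otimes> x [^] n) (k \<otimes> z [^] m)" if "n \<ge> max M N" "m \<ge> max M N" for n m :: nat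
    using linked_trans[OF M[of n "max M N"] N[of "max M N" m]] that by auto
  then show "\<exists>N::nat. \<forall>n\<ge>N. \<forall>m\<ge>N::nat. linked G \<chi> Y r (g \<otimes> x [^] n) (k \<otimes> z [^] m)"
    by blast
qed

text \<open>Points far out on the two rays are both joined to the corner
  \<open>g x^n y^m = g y^m x^n\<close> by translates of paths of bounded depth.\<close>

lemma rays_equiv_commute:
  assumes Y: "Y \<subseteq> carrier G" "generate G Y = carrier G"
    and g: "g \<in> carrier G" and x: "x \<in> carrier G" "\<chi> x > 0" and y: "y \<in> carrier G" "\<chi> y > 0"
    and xy: "x \<otimes> y = y \<otimes> x"
  shows "rays_equiv Y g x g y"
  unfolding rays_equiv_def
proof
  fix r
  obtain a b where "linked G \<chi> Y a \<one> x" "linked G \<chi> Y b \<one> y"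
    using linked_generate[OF Y(1)] Y(2) x y by metis
  \<comment> \<open>One depth serves the paths to all powers of \<open>x\<close> and of
    \<open>y\<close>.\<close>
  define d where "d = min a b"
  have d: "linked G \<chi> Y d \<one> (x [^] (n::nat))" "linked G \<chi> Y d \<one> (y [^] n)" for n
    using linked_mono[OF linked_pow[OF \<open>linked G \<chi> Y a \<one> x\<close> Y(1)], of d]
      linked_mono[OF linked_pow[OF \<open>linked G \<chi> Y b \<one> y\<close> Y(1)], of d] x y
    by (auto simp: d_def)
  \<comment> \<open>From index \<open>N\<close> on, both rays are so high that a path of depth
    \<open>d\<close> starting there stays above \<open>r\<close>.\<close>
  obtain N :: nat where N: "r - \<chi> g - d < real N * min (\<chi> x) (\<chi> y)"
    using reals_Archimedean3[of "min (\<chi> x) (\<chi> y)"] x y by auto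
  have step: "linked G \<chi> Y r (g \<otimes> u [^] n) (g \<otimes> (u [^] n \<otimes> v [^] m))"
    if "u \<in> carrier G" "v \<in> carrier G" "min (\<chi> x) (\<chi> y) \<le> \<chi> u" "n \<ge> N"
      "linked G \<chi> Y d \<one> (v [^] m)" for u v and n m :: nat
  proof -
    have "real N * min (\<chi> x) (\<chi> y) \<le> real n * \<chi> u"
      using that x y by (intro mult_mono) auto
    then have "r \<le> \<chi> (g \<otimes> u [^] n) + d"
      using N that g by simp
    then show ?thesis
      using linked_shift'[OF that(5) _ Y(1), of "g \<otimes> u [^] n" r] that g by (simp add: m_assoc)
  qed
  show "\<exists>N::nat. \<forall>n\<ge>N. \<forall>m\<ge>N::nat. linked G \<chi> Y r (g \<otimes> x [^] (n::nat)) (g \<otimes> y [^] (m::nat))"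
  proof (intro exI allI impI)
    fix n m assume nm: "n \<ge> N" "m \<ge> N"
    have "x [^] n \<otimes> y [^] m = y [^] m \<otimes> x [^] n"
      using xy x y by (metis group_commutes_pow nat_pow_closed)
    then show "linked G \<chi> Y r (g \<otimes> x [^] n) (g \<otimes> y [^] m)"
      using step[OF x(1) y(1) min.cobounded1 nm(1) d(2)[of m]]
        step[OF y(1) x(1) min.cobounded2 nm(2) d(1)[of n]]
      by (auto intro: linked_sym linked_trans)
  qed
qed

text \<open>A path from the identity to \<open>u\<close>, translated by \<open>g x^n\<close>, ends
  in \<open>g x^n u = g u x^n\<close>, and for large \<open>n\<close> it lies above any given
  level.\<close>

lemma rays_equiv_move:
  assumes Y: "Y \<subseteq> carrier G" "generate G Y = carrier G"
    and g: "g \<in> carrier G" and x: "x \<in> carrier G" "\<chi> x > 0" and u: "u \<in> carrier G"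
    and xu: "x \<otimes> u = u \<otimes> x"
  shows "rays_equiv Y (g \<otimes> u) x g x"
proof -
  have "\<exists>N::nat. \<forall>n\<ge>N. \<forall>m\<ge>N::nat. linked G \<chi> Y r (g \<otimes> u \<otimes> x [^] n) (g \<otimes> x [^] m)" for r
  proof -
    obtain a where a: "linked G \<chi> Y a \<one> u"
      using linked_generate[OF Y(1)] Y(2) u by metis
    have "rays_equiv Y g x g x"
      using rays_equiv_commute[OF Y g x x] by simp
    \<comment> \<open>The level \<open>r - a\<close> leaves room for the path to \<open>u\<close>,
      which may descend to \<open>a\<close>; \<open>r\<close> is the level wanted in the
      end.\<close>
    then obtain M where M: "\<And>(n::nat) m::nat. n \<ge> M \<Longrightarrow> m \<ge> M \<Longrightarrow>
        linked G \<chi> Y (max r (r - a)) (g \<otimes> x [^] n) (g \<otimes> x [^] m)"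
      by (rule rays_equivE[where r = "max r (r - a)"]) blast
    have "linked G \<chi> Y r (g \<otimes> u \<otimes> x [^] n) (g \<otimes> x [^] m)" if "n \<ge> M" "m \<ge> M" for n m :: nat
    proof -
      have "r - a \<le> \<chi> (g \<otimes> x [^] n)"
        using linked_closed(3)[OF M[OF that(1) that(1)]] by simp
      then have "linked G \<chi> Y r (g \<otimes> x [^] n) (g \<otimes> x [^] n \<otimes> u)"
        using g x by (intro linked_shift'[OF a _ Y(1)]) auto
      moreover have "g \<otimes> x [^] n \<otimes> u = g \<otimes> u \<otimes> x [^] n"
        using group_commutes_pow[OF xu] g x u by (simp add: m_assoc)
      ultimately have "linked G \<chi> Y r (g \<otimes> u \<otimes> x [^] n) (g \<otimes> x [^] n)"
        by (simp add: linked_sym)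
      then show ?thesis
        using linked_mono[OF M[OF that], of r] by (auto intro: linked_trans)
    qed
    then show ?thesis by blast
  qed
  then show ?thesis unfolding rays_equiv_def by blast
qed

text \<open>Only \<open>\<chi> x \<noteq> 0\<close> matters: then this is the one of
  \<open>x\<close> and its inverse whose powers ascend.\<close>

definition upward :: "'a \<Rightarrow> 'a" where
  "upward x = (if \<chi> x > 0 then x else inv x)"

lemma upward_closed [simp]: "x \<in> carrier G \<Longrightarrow> upward x \<in> carrier G"
  by (simp add: upward_def)

lemma char_upward: "x \<in> carrier G \<Longrightarrow> \<chi> x \<noteq> 0 \<Longrightarrow> \<chi> (upward x) > 0"
  by (simp add: upward_def)

lemma inv_commute:
  assumes "x \<in> carrier G" "y \<in> carrier G" "x \<otimes> y = y \<otimes> x"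
  shows "inv x \<otimes> y = y \<otimes> inv x"
  using assms by (metis inv_closed inv_solve_left inv_solve_right m_assoc m_closed)

lemma upward_commute:
  assumes "x \<in> carrier G" "y \<in> carrier G" "x \<otimes> y = y \<otimes> x"
  shows "upward x \<otimes> y = y \<otimes> upward x"
  using assms inv_commute by (simp add: upward_def)

text \<open>What the argument on rays needs to know about an edge. For label \<open>2 n\<close> a
  witness is \<open>(u v)^n\<close> if it has nonzero value; for a commuting pair it can be a live
  \<open>u\<close> itself.\<close>

definition bridged :: "'a \<Rightarrow> 'a \<Rightarrow> bool" where
  "bridged u v \<longleftrightarrow> (\<exists>z\<in>carrier G. \<chi> z \<noteq> 0 \<and> z \<otimes> u = u \<otimes> z \<and> z \<otimes> v = v \<otimes> z)"

lemma rays_equiv_bridged: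
  assumes Y: "Y \<subseteq> carrier G" "generate G Y = carrier G"
    and g: "g \<in> carrier G"
    and "u \<in> carrier G" "\<chi> u \<noteq> 0" "v \<in> carrier G" "\<chi> v \<noteq> 0" "bridged u v"
  shows "rays_equiv Y g (upward u) g (upward v)"
proof -
  obtain z where z: "z \<in> carrier G" "\<chi> z \<noteq> 0" "z \<otimes> u = u \<otimes> z" "z \<otimes> v = v \<otimes> z"
    using assms(8) unfolding bridged_def by blast
  have "rays_equiv Y g (upward w) g (upward z)"
    if "w \<in> carrier G" "\<chi> w \<noteq> 0" "z \<otimes> w = w \<otimes> z" for w
    using that z upward_commute[OF that(1) upward_closed[OF z(1)]] upward_commute[OF z(1) that(1,3)]
    by (intro rays_equiv_commute[OF Y g]) (simp_all add: char_upward)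
  from this[of u] this[of v] show ?thesis
    using assms z by (blast intro: rays_equiv_sym rays_equiv_trans)
qed

text \<open>Every group element is joined to the end of a ray inside the upper half, and all these ends
  coincide.\<close>

theorem linked_if_bridged:
  assumes Y: "Y \<subseteq> carrier G" "generate G Y = carrier G"
    and nonzero: "\<exists>u\<in>Y. \<chi> u \<noteq> 0"
    and connected: "\<And>u v. u \<in> Y \<Longrightarrow> v \<in> Y \<Longrightarrow> \<chi> u \<noteq> 0 \<Longrightarrow> \<chi> v \<noteq> 0 \<Longrightarrow>
      (u, v) \<in> {(u, v). u \<in> Y \<and> v \<in> Y \<and> \<chi> u \<noteq> 0 \<and> \<chi> v \<noteq> 0 \<and> bridged u v}\<^sup>*"
    and dominating: "\<And>u. u \<in> Y \<Longrightarrow> \<chi> u = 0 \<Longrightarrow> \<exists>v\<in>Y. \<chi> v \<noteq> 0 \<and> bridged u v"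
    and g: "g \<in> carrier G" "\<chi> g \<ge> 0"
  shows "linked G \<chi> Y 0 \<one> g"
proof -
  from nonzero obtain u where u: "u \<in> Y" "\<chi> u \<noteq> 0" by blast
  have uc: "u \<in> carrier G" using u Y by auto
  let ?t = "upward u"
  \<comment> \<open>Bridges are followed from \<open>u\<close> to \<open>v\<close>: from each
    \<open>h\<close>, rays in all live directions have the same end.\<close>
  have live: "rays_equiv Y h ?t h (upward v)" if "v \<in> Y" "\<chi> v \<noteq> 0" "h \<in> carrier G" for v h
    using connected[OF u(1) that(1) u(2) that(2)]
  proof induction
    case base
    show ?case using uc that u by (intro rays_equiv_commute[OF Y]) (auto simp: char_upward)
  next
    case (step v w)
    have "rays_equiv Y h (upward v) h (upward w)"
      using step(2) Y that by (intro rays_equiv_bridged[OF Y]) auto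
    with step(3) show ?case by (rule rays_equiv_trans)
  qed
  have move: "rays_equiv Y (h \<otimes> w) ?t h ?t" if w: "w \<in> Y" and h: "h \<in> carrier G" for w h
  proof -
    have wc: "w \<in> carrier G" using w Y by auto
    \<comment> \<open>A live \<open>w\<close> is bridged to itself, with witness
      \<open>w\<close>.\<close>
    have "\<exists>v\<in>Y. \<chi> v \<noteq> 0 \<and> bridged w v"
      using dominating[OF w] wc w unfolding bridged_def by (cases "\<chi> w = 0") blast+
    then obtain v where v: "v \<in> Y" "\<chi> v \<noteq> 0" "bridged w v" by blast
    have vc: "v \<in> carrier G" using v Y by auto
    from v(3) obtain z where z: "z \<in> carrier G" "\<chi> z \<noteq> 0" "z \<otimes> w = w \<otimes> z" "z \<otimes> v = v \<otimes> z"
      unfolding bridged_def by blast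
    have zv: "rays_equiv Y k (upward z) k (upward v)" if "k \<in> carrier G" for k
      using z v vc that by (intro rays_equiv_bridged[OF Y]) (simp_all, unfold bridged_def, blast)
    \<comment> \<open>Since \<open>z\<close> commutes with \<open>w\<close>, its ray can be moved by
      \<open>w\<close>. The equivalences of rays along \<open>z\<close>, \<open>v\<close> and
      \<open>?t\<close> carry this over to \<open>?t\<close>.\<close>
    have "rays_equiv Y (h \<otimes> w) (upward z) h (upward z)"
      using z h wc upward_commute[OF z(1) wc z(3)]
      by (intro rays_equiv_move[OF Y]) (simp_all add: char_upward)
    moreover have "rays_equiv Y k (upward z) k ?t" if "k \<in> carrier G" for k
      using rays_equiv_trans[OF zv rays_equiv_sym[OF live[OF v(1,2)]]] that by blast
    ultimately show ?thesis
      using h wc by (blast intro: rays_equiv_sym rays_equiv_trans)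
  qed
  \<comment> \<open>The ray is moved letter by letter along a word for \<open>x\<close>, keeping its
    end.\<close>
  have rays: "rays_equiv Y (h \<otimes> x) ?t h ?t" if "x \<in> generate G Y" "h \<in> carrier G" for x h
    using that
  proof (induction arbitrary: h)
    case one
    then show ?case using live[OF u] by simp
  next
    case (incl w)
    then show ?case using move by simp
  next
    case (inv w)
    then have "w \<in> carrier G" using Y by auto
    then show ?case
      using move[OF inv(1), of "h \<otimes> inv w"] inv by (auto simp: m_assoc intro: rays_equiv_sym)
  next
    case (eng x y)
    then have "x \<in> carrier G" "y \<in> carrier G" using Y by auto
    then have "rays_equiv Y (h \<otimes> x \<otimes> y) ?t h ?t"
      using rays_equiv_trans[OF eng(4)[of "h \<otimes> x"] eng(3)[of h]] eng(5) by simp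
    then show ?case
      using eng \<open>x \<in> carrier G\<close> \<open>y \<in> carrier G\<close> by (simp add: m_assoc)
  qed
  have t: "linked G \<chi> Y 0 \<one> ?t"
    using u uc by (intro linked_arc) (auto simp: upper_arcs_def upward_def intro!: bexI[of _ u])
  have up: "linked G \<chi> Y 0 h (h \<otimes> ?t [^] n)" if "h \<in> carrier G" "\<chi> h \<ge> 0" for h and n :: nat
    using linked_pow[OF t Y(1)] char_upward[OF uc u(2)] that Y
    by (intro linked_shift') auto
  \<comment> \<open>The identity and \<open>g\<close> climb along their rays inside the upper half,
    and far out the rays are joined above level 0.\<close>
  have "rays_equiv Y (\<one> \<otimes> g) ?t \<one> ?t"
    using rays[of g \<one>] g Y by simp
  then obtain N where N: "linked G \<chi> Y 0 (\<one> \<otimes> g \<otimes> ?t [^] (N::nat)) (\<one> \<otimes> ?t [^] N)"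
    unfolding rays_equiv_def by blast
  show ?thesis
    using linked_trans[OF up[of \<one> N] linked_sym[OF N]] linked_sym[OF up[of g N]] g
    by (auto intro: linked_trans)
qed

end

section \<open>Passing to the metabelian quotient\<close>

text \<open>Images of paths are paths for the image generators, and an element of the upper half of
  \<open>Q\<close> has its preimages in the upper half of \<open>G\<close>.\<close>

lemma Sigma1_epimorphic_image:
  assumes "group G" "group Q" and \<pi>: "\<pi> \<in> hom G Q" "\<pi> ` carrier G = carrier Q"
    and \<chi>: "\<chi> \<in> nonzero_characters G" and \<psi>: "\<psi> \<in> nonzero_characters Q"
    and \<psi>\<pi>: "\<And>g. g \<in> carrier G \<Longrightarrow> \<psi> (\<pi> g) = \<chi> g"
    and "character_class G \<chi> \<in> Sigma1 G"
  shows "character_class Q \<psi> \<in> Sigma1 Q"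
proof -
  interpret group_hom G Q \<pi>
    using assms by (simp add: group_hom_def group_hom_axioms_def)
  obtain Y where Y: "finite Y" "Y \<subseteq> carrier G" "generate G Y = carrier G"
      "\<And>g. g \<in> carrier G \<Longrightarrow> \<chi> g \<ge> 0 \<Longrightarrow> linked G \<chi> Y 0 \<one>\<^bsub>G\<^esub> g"
    using assms(8) unfolding character_class_in_Sigma1_iff[OF assms(1) \<chi>] by blast
  have push: "linked Q \<psi> (\<pi> ` Y) 0 \<one>\<^bsub>Q\<^esub> (\<pi> g)" if "linked G \<chi> Y 0 \<one>\<^bsub>G\<^esub> g" for g
    using that
  proof (induction rule: linked_induct)
    case refl
    have "\<psi> (\<pi> \<one>\<^bsub>G\<^esub>) = \<chi> \<one>\<^bsub>G\<^esub>" using \<psi>\<pi> by blast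
    then show ?case using linked_closed(3)[OF that] by (auto intro: linked_refl)
  next
    case (step x y)
    have "(\<pi> x, \<pi> y) \<in> upper_arcs Q \<psi> (\<pi> ` Y) 0"
      using step(2) Y(2) \<psi>\<pi> by (auto simp: upper_arcs_def subset_iff)
    with step(3) show ?case by (blast intro: linked_trans linked_arc)
  qed
  have "linked Q \<psi> (\<pi> ` Y) 0 \<one>\<^bsub>Q\<^esub> q" if q: "q \<in> carrier Q" "\<psi> q \<ge> 0" for q
  proof -
    obtain g where "g \<in> carrier G" "q = \<pi> g" using q \<pi>(2) by auto
    then show ?thesis using push Y(4) \<psi>\<pi> q by simp
  qed
  moreover have "generate Q (\<pi> ` Y) = carrier Q"
    using generate_img[OF Y(2)] Y(3) \<pi>(2) by simp
  ultimately show ?thesis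
    unfolding character_class_in_Sigma1_iff[OF assms(2) \<psi>]
    using Y(1,2) by (intro exI[of _ "\<pi> ` Y"]) auto
qed

text \<open>The affine maps \<open>m \<mapsto> f + z \<cdot> \<tau>\<^sup>r m\<close> of the \<open>\<complex>[\<real>]\<close>-module of functions \<open>\<real> \<rightarrow> \<complex>\<close> with support
  bounded below, where \<open>\<tau>\<^sup>r\<close> is translation by \<open>r\<close>.\<close>

definition shift_affine_group :: "(real \<times> complex \<times> (real \<Rightarrow> complex)) monoid" where
  "shift_affine_group =
    \<lparr>carrier = {(r, z, f). z \<noteq> 0 \<and> (\<exists>b. \<forall>x<b. f x = 0)},
     monoid.mult = (\<lambda>(r, z, f) (s, w, g). (r + s, z * w, \<lambda>x. f x + z * g (x - r))),
     one = (0, 1, \<lambda>x. 0)\<rparr>"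

lemma shift_affine_simps [simp]:
  "(r, z, f) \<in> carrier shift_affine_group \<longleftrightarrow> z \<noteq> 0 \<and> (\<exists>b. \<forall>x<b. f x = 0)"
  "(r, z, f) \<otimes>\<^bsub>shift_affine_group\<^esub> (s, w, g) = (r + s, z * w, \<lambda>x. f x + z * g (x - r))"
  "\<one>\<^bsub>shift_affine_group\<^esub> = (0, 1, \<lambda>x. 0)"
  by (auto simp: shift_affine_group_def)

lemma group_shift_affine_group: "group shift_affine_group"
proof (rule groupI)
  let ?A = shift_affine_group
  fix p q assume "p \<in> carrier ?A" "q \<in> carrier ?A"
  moreover obtain r z f s w g where "p = (r, z, f)" "q = (s, w, g)" by (cases p, cases q)
  ultimately show "p \<otimes>\<^bsub>?A\<^esub> q \<in> carrier ?A"
  proof (clarsimp)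
    fix a b :: real assume "\<forall>x<a. f x = 0" "\<forall>x<b. g x = 0"
    then show "\<exists>c. \<forall>x<c. f x + z * g (x - r) = 0"
      by (intro exI[of _ "min a (b + r)"]) auto
  qed
next
  let ?A = shift_affine_group
  fix p assume "p \<in> carrier ?A"
  moreover obtain r z f where p: "p = (r, z, f)" by (cases p)
  ultimately obtain b where b: "z \<noteq> 0" "\<forall>x<b. f x = 0" by auto
  have "\<exists>c. \<forall>x<c. f (x + r) = 0"
    using b by (intro exI[of _ "b - r"]) auto
  then have "(- r, inverse z, \<lambda>x. - inverse z * f (x + r)) \<in> carrier ?A"
    using b(1) by auto
  then show "\<exists>q\<in>carrier ?A. q \<otimes>\<^bsub>?A\<^esub> p = \<one>\<^bsub>?A\<^esub>"
    by (rule bexI[rotated]) (use b in \<open>simp add: p\<close>)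
qed (auto simp: algebra_simps shift_affine_group_def)

lemma shift_affine_pow:
  "(0, z, f) [^]\<^bsub>shift_affine_group\<^esub> (n::nat) = (0, z ^ n, \<lambda>x. (\<Sum>i<n. z ^ i) * f x)"
proof (induction n)
  case (Suc n)
  then show ?case by (simp add: fun_eq_iff algebra_simps)
qed (simp add: nat_pow_def)

text \<open>As \<open>z \<noteq> 1\<close>, the geometric sum vanishes; equivalently, the map is
  multiplication by \<open>z\<close> about a fixed point. This lets noncommuting images of the ends
  of a dead edge satisfy its relation.\<close>

lemma shift_affine_torsion:
  assumes "z ^ n = 1" "z \<noteq> 1"
  shows "(0, z, f) [^]\<^bsub>shift_affine_group\<^esub> (n::nat) = (0, 1, \<lambda>x. 0)"
  using assms by (simp add: shift_affine_pow geometric_sum)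

text \<open>The group is metabelian: linear parts commute, so commutators are pure translations, and
  these (the subgroup \<open>N\<close>) commute with each other.\<close>

lemma second_derived_shift_affine_group: "second_derived shift_affine_group = {(0, 1, \<lambda>x. 0)}"
proof -
  let ?A = shift_affine_group
  interpret group ?A by (rule group_shift_affine_group)
  define N where "N = {p \<in> carrier ?A. fst p = 0 \<and> fst (snd p) = 1}"
  have lin: "fst (p \<otimes>\<^bsub>?A\<^esub> q) = fst p + fst q" "fst (snd (p \<otimes>\<^bsub>?A\<^esub> q)) = fst (snd p) * fst (snd q)" for p q
    by (cases p, cases q, simp)+
  have lin_inv: "fst (inv\<^bsub>?A\<^esub> p) = - fst p" "fst (snd (inv\<^bsub>?A\<^esub> p)) = inverse (fst (snd p))"
    if "p \<in> carrier ?A" for p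
  proof -
    have "fst (p \<otimes>\<^bsub>?A\<^esub> inv\<^bsub>?A\<^esub> p) = 0" "fst (snd (p \<otimes>\<^bsub>?A\<^esub> inv\<^bsub>?A\<^esub> p)) = 1"
      using that by simp_all
    then have "fst p + fst (inv\<^bsub>?A\<^esub> p) = 0" "fst (snd p) * fst (snd (inv\<^bsub>?A\<^esub> p)) = 1"
      unfolding lin .
    then show "fst (inv\<^bsub>?A\<^esub> p) = - fst p" "fst (snd (inv\<^bsub>?A\<^esub> p)) = inverse (fst (snd p))"
      using inverse_unique[of "fst (snd p)"] by auto
  qed
  have N: "subgroup N ?A"
    by (rule subgroupI) (auto simp: N_def lin lin_inv simp del: shift_affine_simps(3) intro!: exI[of _ "\<one>\<^bsub>?A\<^esub>"])
  have nz: "fst (snd p) \<noteq> 0" if "p \<in> carrier ?A" for p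
    using that by (cases p) auto
  have "p \<otimes>\<^bsub>?A\<^esub> q \<otimes>\<^bsub>?A\<^esub> inv\<^bsub>?A\<^esub> p \<otimes>\<^bsub>?A\<^esub> inv\<^bsub>?A\<^esub> q \<in> N"
    if "p \<in> carrier ?A" "q \<in> carrier ?A" for p q
    using that nz[OF that(1)] nz[OF that(2)] by (simp add: N_def lin lin_inv field_simps del: shift_affine_simps)
  then have "derived ?A (carrier ?A) \<subseteq> N"
    unfolding derived_def by (intro generate_subgroup_incl[OF _ N]) blast
  moreover have comm: "p \<otimes>\<^bsub>?A\<^esub> q = q \<otimes>\<^bsub>?A\<^esub> p" if "p \<in> N" "q \<in> N" for p q
    using that by (cases p, cases q) (auto simp: N_def)
  moreover have "N \<subseteq> carrier ?A" by (auto simp: N_def)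
  ultimately have "derived_set ?A (derived ?A (carrier ?A)) \<subseteq> {\<one>\<^bsub>?A\<^esub>}"
  proof -
    have "p \<otimes>\<^bsub>?A\<^esub> q \<otimes>\<^bsub>?A\<^esub> inv\<^bsub>?A\<^esub> p \<otimes>\<^bsub>?A\<^esub> inv\<^bsub>?A\<^esub> q = \<one>\<^bsub>?A\<^esub>" if "p \<in> N" "q \<in> N" for p q
    proof -
      have "p \<in> carrier ?A" "q \<in> carrier ?A" using that by (auto simp: N_def)
      then have "p \<otimes>\<^bsub>?A\<^esub> q \<otimes>\<^bsub>?A\<^esub> inv\<^bsub>?A\<^esub> p \<otimes>\<^bsub>?A\<^esub> inv\<^bsub>?A\<^esub> q = q \<otimes>\<^bsub>?A\<^esub> (p \<otimes>\<^bsub>?A\<^esub> inv\<^bsub>?A\<^esub> p) \<otimes>\<^bsub>?A\<^esub> inv\<^bsub>?A\<^esub> q"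
        using comm[OF that] by (simp add: m_assoc del: shift_affine_simps r_inv)
      then show ?thesis
        using \<open>p \<in> carrier ?A\<close> \<open>q \<in> carrier ?A\<close> by (simp del: shift_affine_simps)
    qed
    then show ?thesis using \<open>derived ?A (carrier ?A) \<subseteq> N\<close> by blast
  qed
  then have "second_derived ?A \<subseteq> {\<one>\<^bsub>?A\<^esub>}"
    unfolding second_derived_def derived_def[of _ "derived ?A (carrier ?A)"]
    by (rule generate_subgroup_incl[OF _ triv_subgroup])
  moreover have "\<one>\<^bsub>?A\<^esub> \<in> second_derived ?A"
    unfolding second_derived_def derived_def[of _ "derived ?A (carrier ?A)"] by (rule generate.one)
  ultimately show ?thesis by auto
qed

text \<open>Along paths in the upper half the translation parts have supports bounded below uniformly, whereas
  conjugating a pure translation by elements of very negative character value shifts its support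
  arbitrarily far to the left.\<close>

lemma not_Sigma1_if_affine_action:
  assumes "group G" and \<chi>: "\<chi> \<in> nonzero_characters G"
    and \<rho>: "\<rho> \<in> hom G shift_affine_group" "\<And>g. g \<in> carrier G \<Longrightarrow> fst (\<rho> g) = \<chi> g"
    and ab: "a \<in> carrier G" "b \<in> carrier G" "\<rho> (a \<otimes>\<^bsub>G\<^esub> b) \<noteq> \<rho> (b \<otimes>\<^bsub>G\<^esub> a)"
  shows "character_class G \<chi> \<notin> Sigma1 G"
proof
  assume "character_class G \<chi> \<in> Sigma1 G"
  then obtain Y where Y: "finite Y" "Y \<subseteq> carrier G"
      "\<And>g. g \<in> carrier G \<Longrightarrow> \<chi> g \<ge> 0 \<Longrightarrow> linked G \<chi> Y 0 \<one>\<^bsub>G\<^esub> g"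
    unfolding character_class_in_Sigma1_iff[OF assms(1) \<chi>] by blast
  interpret G: character G \<chi>
    using assms by (simp add: character_def character_axioms_def nonzero_characters_def)
  let ?A = shift_affine_group
  interpret \<rho>: group_hom G ?A \<rho>
    using assms group_shift_affine_group by (simp add: group_hom_def group_hom_axioms_def)
  define z f where "z g = fst (snd (\<rho> g))" and "f g = snd (snd (\<rho> g))" for g
  have \<rho>_eq: "\<rho> g = (\<chi> g, z g, f g)" if "g \<in> carrier G" for g
    using \<rho>(2)[OF that] by (simp add: z_def f_def prod_eq_iff)
  have \<rho>_mult: "z (g \<otimes>\<^bsub>G\<^esub> h) = z g * z h" "f (g \<otimes>\<^bsub>G\<^esub> h) x = f g x + z g * f h (x - \<chi> g)"
    if "g \<in> carrier G" "h \<in> carrier G" for g h x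
    using \<rho>.hom_mult[OF that] \<rho>_eq that by auto
  have z_nz: "z g \<noteq> 0" and f_bound: "\<exists>b. \<forall>x<b. f g x = 0" if "g \<in> carrier G" for g
    using \<rho>.hom_closed[OF that] \<rho>_eq[OF that] by auto
  \<comment> \<open>As \<open>Y\<close> is finite, one bound serves the translation parts of all
    generators.\<close>
  have "\<exists>b. \<forall>y\<in>Y. \<forall>x<b. f y x = 0"
    using Y(1,2)
  proof (induction Y)
    case (insert y Y)
    then obtain b c where "\<forall>y\<in>Y. \<forall>x<b. f y x = 0" "\<forall>x<c. f y x = 0"
      using f_bound[of y] by auto
    then show ?case by (intro exI[of _ "min b c"]) auto
  qed simp
  then obtain B where B: "\<And>y x. y \<in> Y \<Longrightarrow> x < B \<Longrightarrow> f y x = 0" by blast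
  \<comment> \<open>An arc labelled \<open>y\<close> changes the translation part by a multiple of
    \<open>f y\<close> shifted by the value at its tail. That value is nonnegative, so nothing
    appears to the left of \<open>B\<close>.\<close>
  have supp: "\<forall>x<B. f g x = 0" if "linked G \<chi> Y 0 \<one>\<^bsub>G\<^esub> g" for g
    using that
  proof (induction rule: linked_induct)
    case refl
    show ?case using \<rho>.hom_one \<rho>_eq[OF G.one_closed] by (auto simp: fun_eq_iff)
  next
    case (step g h)
    then obtain y where y: "y \<in> Y" "h = g \<otimes>\<^bsub>G\<^esub> y \<or> g = h \<otimes>\<^bsub>G\<^esub> y"
        and gh: "g \<in> carrier G" "h \<in> carrier G" "\<chi> g \<ge> 0" "\<chi> h \<ge> 0"
      by (auto simp: upper_arcs_def)
    have "y \<in> carrier G" using y Y by auto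
    then show ?case
      using y(2) step(3) gh \<rho>_mult(2)[of g y] \<rho>_mult(2)[of h y] B[OF y(1)] by auto
  qed
  \<comment> \<open>The commutator \<open>c\<close> acts as a pure translation, a nonzero one
    because \<open>a b\<close> and \<open>b a\<close> act differently.\<close>
  obtain c where c: "c \<in> carrier G" "c \<otimes>\<^bsub>G\<^esub> (b \<otimes>\<^bsub>G\<^esub> a) = a \<otimes>\<^bsub>G\<^esub> b" "\<chi> c = 0"
  proof
    show "a \<otimes>\<^bsub>G\<^esub> b \<otimes>\<^bsub>G\<^esub> inv\<^bsub>G\<^esub> (b \<otimes>\<^bsub>G\<^esub> a) \<otimes>\<^bsub>G\<^esub> (b \<otimes>\<^bsub>G\<^esub> a) = a \<otimes>\<^bsub>G\<^esub> b"
      using ab(1,2) by (simp add: G.m_assoc del: G.inv_mult_group)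
  qed (use ab(1,2) in simp_all)
  have zc: "z c = 1"
    using \<rho>_mult(1)[OF c(1), of "b \<otimes>\<^bsub>G\<^esub> a"] ab(1,2) c(2) z_nz[of a] z_nz[of b] by (auto simp: \<rho>_mult(1))
  obtain x where x: "f c x \<noteq> 0"
  proof (rule ccontr)
    assume "\<not> thesis"
    then have "f c x = 0" for x using that by blast
    then have "f (a \<otimes>\<^bsub>G\<^esub> b) = f (b \<otimes>\<^bsub>G\<^esub> a)"
      using \<rho>_mult(2)[OF c(1), of "b \<otimes>\<^bsub>G\<^esub> a"] ab(1,2) c(2,3) zc by (simp add: fun_eq_iff)
    then show False
      using ab \<rho>_eq[of "a \<otimes>\<^bsub>G\<^esub> b"] \<rho>_eq[of "b \<otimes>\<^bsub>G\<^esub> a"] by (simp add: \<rho>_mult(1))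
  qed
  \<comment> \<open>Conjugation by \<open>k\<close> will move the point \<open>x\<close> of the
    support of \<open>f c\<close> to \<open>x + \<chi> k\<close>, left of \<open>B\<close>.\<close>
  obtain k where k: "k \<in> carrier G" "x + \<chi> k < B"
  proof -
    obtain h where h: "h \<in> carrier G" "\<chi> h \<noteq> 0"
      using \<chi> by (auto simp: nonzero_characters_def)
    define h' where "h' = (if \<chi> h < 0 then h else inv\<^bsub>G\<^esub> h)"
    have h': "h' \<in> carrier G" "\<chi> h' < 0" using h by (auto simp: h'_def)
    obtain n :: nat where "x - B < real n * - \<chi> h'"
      using reals_Archimedean3[of "- \<chi> h'"] h'(2) by auto
    then show thesis using h' by (intro that[of "h' [^]\<^bsub>G\<^esub> n"]) auto
  qed
  \<comment> \<open>The conjugate \<open>d\<close> of \<open>c\<close> by \<open>k\<close> has value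
    0, so \<open>supp\<close> applies to it, although \<open>f d\<close> does not vanish at
    \<open>x + \<chi> k\<close>.\<close>
  obtain d where d: "d \<in> carrier G" "d \<otimes>\<^bsub>G\<^esub> k = k \<otimes>\<^bsub>G\<^esub> c" "\<chi> d = 0"
  proof
    show "k \<otimes>\<^bsub>G\<^esub> c \<otimes>\<^bsub>G\<^esub> inv\<^bsub>G\<^esub> k \<otimes>\<^bsub>G\<^esub> k = k \<otimes>\<^bsub>G\<^esub> c"
      using c k(1) by (simp add: G.m_assoc)
  qed (use c k(1) in simp_all)
  have "z d * z k = z k"
    using \<rho>_mult(1)[OF d(1) k(1)] d(2) \<rho>_mult(1)[OF k(1) c(1)] zc by simp
  then have zd: "z d = 1" using z_nz[OF k(1)] by simp
  have "f d (x + \<chi> k) = z k * f c x"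
    using \<rho>_mult(2)[OF d(1) k(1), of "x + \<chi> k"] \<rho>_mult(2)[OF k(1) c(1), of "x + \<chi> k"] d(2,3) zd
    by simp
  moreover have "f d (x + \<chi> k) = 0"
    using supp[OF Y(3)[OF d(1)]] d(3) k(2) by simp
  ultimately show False
    using z_nz[OF k(1)] x by simp
qed

section \<open>Descent to the quotient by the second derived subgroup\<close>

lemma second_derived_normal:
  assumes "group G"
  shows "second_derived G \<lhd> G"
proof -
  interpret group G by fact
  show ?thesis
    unfolding second_derived_def by (intro derived_is_normal normal_self)
qed

lemma induced_map_nonzero_character:
  assumes "group G" "\<chi> \<in> nonzero_characters G"
  shows "induced_map \<chi> \<in> nonzero_characters (G Mod second_derived G)"
proof -
  let ?N = "second_derived G"
  interpret normal ?N G by (rule second_derived_normal[OF assms(1)])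
  have hom: "\<chi> \<in> hom G real_group" using assms(2) by (simp add: nonzero_characters_def)
  interpret character G \<chi> using assms(1) hom by (simp add: character_def character_axioms_def)
  note ind = induced_map_second_derived[OF assms(1) hom]
  have "induced_map \<chi> \<in> hom (G Mod ?N) real_group"
    by (rule homI) (auto simp: carrier_FactGroup rcos_sum ind real_group_def)
  then show ?thesis
    using assms(2) by (auto simp: nonzero_characters_def carrier_FactGroup ind)
qed

lemma Sigma1_second_derived_quotient:
  assumes "group G" "\<chi> \<in> nonzero_characters G" "character_class G \<chi> \<in> Sigma1 G"
  shows "character_class (G Mod second_derived G) (induced_map \<chi>) \<in> Sigma1 (G Mod second_derived G)"
proof (rule Sigma1_epimorphic_image[OF assms(1) _ _ _ assms(2) _ _ assms(3)])
  let ?N = "second_derived G"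
  interpret normal ?N G by (rule second_derived_normal[OF assms(1)])
  show "group (G Mod ?N)" by (rule factorgroup_is_group)
  show "(\<lambda>g. ?N #>\<^bsub>G\<^esub> g) \<in> hom G (G Mod ?N)" by (rule r_coset_hom_Mod)
  show "(\<lambda>g. ?N #>\<^bsub>G\<^esub> g) ` carrier G = carrier (G Mod ?N)" by (simp add: carrier_FactGroup)
  show "induced_map \<chi> \<in> nonzero_characters (G Mod ?N)"
    by (rule induced_map_nonzero_character[OF assms(1,2)])
  show "induced_map \<chi> (?N #>\<^bsub>G\<^esub> g) = \<chi> g" if "g \<in> carrier G" for g
    using induced_map_second_derived[OF assms(1) _ that] assms(2)
    by (simp add: nonzero_characters_def)
qed

text \<open>The affine group is metabelian, so \<open>\<rho>\<close> kills
  \<open>second_derived G\<close> and factors through the quotient. The factored action is still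
  nonabelian, and the obstruction applies to it.\<close>

lemma not_Sigma1_second_derived_quotient:
  assumes G: "group G" and \<chi>: "\<chi> \<in> nonzero_characters G"
    and \<rho>: "\<rho> \<in> hom G shift_affine_group" "\<And>g. g \<in> carrier G \<Longrightarrow> fst (\<rho> g) = \<chi> g"
    and ab: "a \<in> carrier G" "b \<in> carrier G" "\<rho> (a \<otimes>\<^bsub>G\<^esub> b) \<noteq> \<rho> (b \<otimes>\<^bsub>G\<^esub> a)"
  shows "character_class (G Mod second_derived G) (induced_map \<chi>) \<notin> Sigma1 (G Mod second_derived G)"
proof -
  let ?N = "second_derived G" and ?A = shift_affine_group
  interpret N: normal ?N G by (rule second_derived_normal[OF G])
  interpret \<rho>: group_hom G ?A \<rho>
    using G \<rho> group_shift_affine_group by (simp add: group_hom_def group_hom_axioms_def)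
  have img: "\<rho> ` carrier G \<subseteq> carrier ?A" by auto
  have "\<rho> ` ?N = derived ?A (derived ?A (\<rho> ` carrier G))"
    unfolding second_derived_def by (simp add: \<rho>.derived_img group.derived_in_carrier[OF G])
  also have "\<dots> \<subseteq> second_derived ?A"
    unfolding second_derived_def by (intro \<rho>.H.mono_derived img)
  finally have ker: "\<rho> n = \<one>\<^bsub>?A\<^esub>" if "n \<in> ?N" for n
    using that second_derived_shift_affine_group by auto
  have "\<rho> x = \<rho> y" if "x \<in> carrier G" "y \<in> carrier G" "?N #>\<^bsub>G\<^esub> x = ?N #>\<^bsub>G\<^esub> y" for x y
  proof -
    have "x \<in> ?N #>\<^bsub>G\<^esub> y" using that N.rcos_self[OF that(1) N.subgroup_axioms] by simp
    then obtain n where n: "n \<in> ?N" "x = n \<otimes>\<^bsub>G\<^esub> y" by (auto simp: r_coset_def)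
    then have "\<rho> x = \<one>\<^bsub>?A\<^esub> \<otimes>\<^bsub>?A\<^esub> \<rho> y"
      using ker[OF n(1)] that N.subset by auto
    also have "\<dots> = \<rho> y" using \<rho>.hom_closed[OF that(2)] by (rule \<rho>.H.l_one)
    finally show ?thesis .
  qed
  then obtain \<rho>' where \<rho>': "\<rho>' \<in> hom (G Mod ?N) ?A" "\<And>x. x \<in> carrier G \<Longrightarrow> \<rho>' (?N #>\<^bsub>G\<^esub> x) = \<rho> x"
    using FactGroup_universal[OF \<rho>(1) second_derived_normal[OF G]] by blast
  have hom: "\<chi> \<in> hom G real_group" using \<chi> by (simp add: nonzero_characters_def)
  have "\<rho>' ((?N #>\<^bsub>G\<^esub> a) \<otimes>\<^bsub>G Mod ?N\<^esub> (?N #>\<^bsub>G\<^esub> b)) \<noteq> \<rho>' ((?N #>\<^bsub>G\<^esub> b) \<otimes>\<^bsub>G Mod ?N\<^esub> (?N #>\<^bsub>G\<^esub> a))"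
    using ab \<rho>' by (simp add: N.rcos_sum)
  moreover have "fst (\<rho>' q) = induced_map \<chi> q" if "q \<in> carrier (G Mod ?N)" for q
    using that \<rho>'(2) \<rho>(2) induced_map_second_derived[OF G hom] by (auto simp: carrier_FactGroup)
  ultimately show ?thesis
    using ab(1,2) by (intro not_Sigma1_if_affine_action[OF N.factorgroup_is_group
      induced_map_nonzero_character[OF G \<chi>] \<rho>'(1)]) (auto simp: carrier_FactGroup)
qed

section \<open>Homomorphisms from a presented group\<close>

fun word_value :: "('b, 'c) monoid_scheme \<Rightarrow> ('a \<Rightarrow> 'b) \<Rightarrow> 'a word \<Rightarrow> 'b" where
  "word_value H \<phi> [] = \<one>\<^bsub>H\<^esub>"
| "word_value H \<phi> ((x, e) # w) = (if e then \<phi> x else inv\<^bsub>H\<^esub> \<phi> x) \<otimes>\<^bsub>H\<^esub> word_value H \<phi> w"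

context group
begin

lemma word_value_closed [simp]:
  assumes "\<phi> \<in> S \<rightarrow> carrier G" "w \<in> words S"
  shows "word_value G \<phi> w \<in> carrier G"
  using assms(2) by (induction w) (use assms(1) in \<open>auto simp: Pi_iff\<close>)

lemma word_value_append:
  assumes "\<phi> \<in> S \<rightarrow> carrier G" "v \<in> words S" "w \<in> words S"
  shows "word_value G \<phi> (v @ w) = word_value G \<phi> v \<otimes> word_value G \<phi> w"
  using assms(2) assms(1,3) by (induction v) (auto simp: m_assoc Pi_iff)

lemma word_value_pres_eq:
  assumes "\<phi> \<in> S \<rightarrow> carrier G" "R \<subseteq> words S \<times> words S"
    and R: "\<And>r s. (r, s) \<in> R \<Longrightarrow> word_value G \<phi> r = word_value G \<phi> s"
    and "pres_eq S R v w"
  shows "word_value G \<phi> v = word_value G \<phi> w"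
  using assms(4)
proof induction
  case (cancel a b x e)
  then have "\<phi> x \<in> carrier G" using assms(1) by auto
  moreover have "word_value G \<phi> b \<in> carrier G" using assms(1) cancel by simp
  moreover have "word_value G \<phi> (a @ [(x, e), (x, \<not> e)] @ b) =
      word_value G \<phi> a \<otimes> word_value G \<phi> ([(x, e), (x, \<not> e)] @ b)"
    using cancel by (intro word_value_append[OF assms(1)]) auto
  ultimately show ?case
    using cancel by (simp add: word_value_append[OF assms(1)] m_assoc[symmetric])
next
  case (rel a b r s)
  then have "r \<in> words S" "s \<in> words S" using assms(2) by auto
  then show ?case
    using rel R[OF rel(3)] by (simp add: word_value_append[OF assms(1)])
qed auto

text \<open>Turns an Artin relation with even label \<open>2 n\<close> into
  \<open>(u v)^n = (v u)^n\<close>.\<close>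

lemma word_value_alt_word:
  assumes "\<phi> u \<in> carrier G" "\<phi> v \<in> carrier G"
  shows "word_value G \<phi> (alt_word u v (2 * n)) = (\<phi> u \<otimes> \<phi> v) [^] n"
proof (induction n)
  case 0
  show ?case by (simp add: alt_word_def)
next
  case (Suc n)
  have "alt_word u v (2 * Suc n) = alt_word u v (2 * n) @ [(u, True), (v, True)]"
    by (simp add: alt_word_def)
  moreover have "alt_word u v (2 * n) \<in> words {u, v}"
    by (auto simp: alt_word_def words_def)
  ultimately show ?case
    using Suc assms word_value_append[of \<phi> "{u, v}" "alt_word u v (2 * n)" "[(u, True), (v, True)]"]
    by auto
qed

text \<open>In every group \<open>(a b)^k a = a (b a)^k\<close>; the hypothesis turns this into
  commutation. The power \<open>(x y)^n\<close> later serves as a bridge.\<close>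

lemma power_product_commute:
  assumes "x \<in> carrier G" "y \<in> carrier G" "(x \<otimes> y) [^] (n::nat) = (y \<otimes> x) [^] n"
  shows "(x \<otimes> y) [^] n \<otimes> x = x \<otimes> (x \<otimes> y) [^] n" "(x \<otimes> y) [^] n \<otimes> y = y \<otimes> (x \<otimes> y) [^] n"
proof -
  have *: "(a \<otimes> b) [^] k \<otimes> a = a \<otimes> (b \<otimes> a) [^] k" if "a \<in> carrier G" "b \<in> carrier G" for a b and k :: nat
  proof (induction k)
    case (Suc k)
    have "(a \<otimes> b) [^] Suc k \<otimes> a = (a \<otimes> b) [^] k \<otimes> a \<otimes> (b \<otimes> a)"
      using that by (simp add: m_assoc)
    then show ?case
      using Suc that by (simp add: m_assoc)
  qed (use that in simp)
  show "(x \<otimes> y) [^] n \<otimes> x = x \<otimes> (x \<otimes> y) [^] n" "(x \<otimes> y) [^] n \<otimes> y = y \<otimes> (x \<otimes> y) [^] n"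
    using *[of x y n] *[of y x n] assms by simp_all
qed

end

text \<open>Von Dyck's theorem: the value of a word is constant on each class, so
  \<open>the_elem\<close> can read it off.\<close>

lemma presented_group_hom:
  assumes H: "group H" and R: "R \<subseteq> words S \<times> words S" and \<phi>: "\<phi> \<in> S \<rightarrow> carrier H"
    and rels: "\<And>r s. (r, s) \<in> R \<Longrightarrow> word_value H \<phi> r = word_value H \<phi> s"
  obtains \<rho> where "\<rho> \<in> hom (presented_group S R) H"
    "\<And>w. w \<in> words S \<Longrightarrow> \<rho> (pres_rel S R `` {w}) = word_value H \<phi> w"
proof
  interpret H: group H by fact
  let ?\<rho> = "\<lambda>C. the_elem (word_value H \<phi> ` C)"
  show \<rho>: "?\<rho> (pres_rel S R `` {w}) = word_value H \<phi> w" if "w \<in> words S" for w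
  proof -
    have "word_value H \<phi> v = word_value H \<phi> w" if "v \<in> pres_rel S R `` {w}" for v
      using H.word_value_pres_eq[OF \<phi> R rels, of w v] that by (simp add: pres_rel_def)
    moreover have "w \<in> pres_rel S R `` {w}"
      using that by (auto simp: pres_rel_def intro: pres_eq.refl)
    ultimately have "word_value H \<phi> ` (pres_rel S R `` {w}) = {word_value H \<phi> w}" by blast
    then show ?thesis by simp
  qed
  have car: "carrier (presented_group S R) = (\<lambda>w. pres_rel S R `` {w}) ` words S"
    by (auto simp: presented_group_def quotient_def)
  show "?\<rho> \<in> hom (presented_group S R) H"
    by (rule homI) (auto simp: car \<rho> presented_group_mult[OF R] H.word_value_append[OF \<phi>] H.word_value_closed[OF \<phi>]
      simp del: Image_singleton_iff)
qed

lemma pres_class_eq: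
  assumes "R \<subseteq> words S \<times> words S" "pres_eq S R v w"
  shows "pres_rel S R `` {v} = pres_rel S R `` {w}"
  using assms by (intro equiv_class_eq[OF equiv_pres_rel]) (simp_all add: pres_rel_def)

definition generator :: "'a set \<Rightarrow> ('a word \<times> 'a word) set \<Rightarrow> 'a \<Rightarrow> 'a word set" where
  "generator S R x = pres_rel S R `` {[(x, True)]}"

lemma generator_closed [simp]: "x \<in> S \<Longrightarrow> generator S R x \<in> carrier (presented_group S R)"
  by (auto simp: generator_def presented_group_def intro!: quotientI)

text \<open>The point is that a formal inverse letter represents the inverse element, by free
  cancellation.\<close>

lemma word_value_generator:
  assumes R: "R \<subseteq> words S \<times> words S" and "w \<in> words S"
  shows "word_value (presented_group S R) (generator S R) w = pres_rel S R `` {w}"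
  using assms(2)
proof (induction w)
  case Nil
  show ?case by (simp add: presented_group_def)
next
  case (Cons l w)
  let ?G = "presented_group S R"
  interpret group ?G by (rule group_presented_group[OF R])
  obtain x e where l: "l = (x, e)" by (cases l)
  with Cons have x: "x \<in> S" and w: "w \<in> words S" by auto
  have "pres_rel S R `` {[(x, False)]} \<otimes>\<^bsub>?G\<^esub> generator S R x = pres_rel S R `` {[(x, False), (x, True)]}"
    unfolding generator_def using x by (subst presented_group_mult[OF R]) auto
  also have "\<dots> = \<one>\<^bsub>?G\<^esub>"
    using pres_class_eq[OF R] pres_eq.cancel[of "[]" S "[]" x R False] x
    by (simp add: presented_group_def)
  finally have "inv\<^bsub>?G\<^esub> generator S R x = pres_rel S R `` {[(x, False)]}"
  proof (rule inv_equality)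
    show "pres_rel S R `` {[(x, False)]} \<in> carrier ?G"
      using x by (auto simp: presented_group_def intro!: quotientI)
  qed (use x in simp)
  then have "(if e then generator S R x else inv\<^bsub>?G\<^esub> generator S R x) = pres_rel S R `` {[l]}"
    by (simp add: generator_def l)
  then show ?case
    using Cons(1)[OF w] presented_group_mult[OF R, of "[l]" w] x w by (simp add: l)
qed

lemma generate_generator:
  assumes R: "R \<subseteq> words S \<times> words S"
  shows "generate (presented_group S R) (generator S R ` S) = carrier (presented_group S R)"
proof
  let ?G = "presented_group S R" and ?Y = "generator S R ` S"
  interpret group ?G by (rule group_presented_group[OF R])
  show "generate ?G ?Y \<subseteq> carrier ?G"
    by (rule generate_incl) auto
  have "word_value ?G (generator S R) w \<in> generate ?G ?Y" if "w \<in> words S" for w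
    using that
    by (induction w) (auto intro: generate.one intro!: generate.eng[OF generate.incl] generate.eng[OF generate.inv])
  then show "carrier ?G \<subseteq> generate ?G ?Y"
    using word_value_generator[OF R] by (auto simp: presented_group_def elim!: quotientE)
qed

lemma (in group) hom_eq_on_generate:
  assumes "group H" "\<phi> \<in> hom G H" "\<psi> \<in> hom G H" "Y \<subseteq> carrier G"
    and "\<And>y. y \<in> Y \<Longrightarrow> \<phi> y = \<psi> y" and "x \<in> generate G Y"
  shows "\<phi> x = \<psi> x"
proof -
  interpret \<phi>: group_hom G H \<phi> using assms by (simp add: group_hom_def group_hom_axioms_def is_group)
  interpret \<psi>: group_hom G H \<psi> using assms by (simp add: group_hom_def group_hom_axioms_def is_group)
  from assms(6) show ?thesis
  proof induction
    case (eng g h)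
    then have "g \<in> carrier G" "h \<in> carrier G" using generate_in_carrier[OF assms(4)] by auto
    then show ?case using eng by simp
  qed (use assms(4,5) in auto)
qed

section \<open>Prescribed ratios along the edges of a forest\<close>

text \<open>Induction on the edges. The ends of a removed edge lie in different components of the
  rest, as otherwise it would close a cycle; rescaling the solution on one component then fits the
  removed edge.\<close>

lemma forest_potential:
  fixes c :: "'v \<Rightarrow> 'v \<Rightarrow> complex"
  assumes "pair_graph \<Gamma>" and "A \<subseteq> parcs \<Gamma>" "sym A"
    and c: "\<And>u v. (u, v) \<in> A \<Longrightarrow> c u v * c v u = 1"
    and "\<And>p. closed_reduced_path \<Gamma> p \<Longrightarrow> \<not> set p \<subseteq> A"
  shows "\<exists>s. (\<forall>u. s u \<noteq> 0) \<and> (\<forall>(u, v)\<in>A. s u = c u v * s v)"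
proof -
  interpret pair_graph \<Gamma> by fact
  have "finite A" using assms(2) pair_finite_arcs by (rule finite_subset)
  then show ?thesis
    using assms(2-)
  proof (induction A rule: finite_psubset_induct)
    case (psubset A)
    show ?case
    proof (cases "A = {}")
      case True
      then show ?thesis by (intro exI[of _ "\<lambda>_. 1"]) simp
    next
      case False
      then obtain u v where uv: "(u, v) \<in> A" by auto
      then have vu: "(v, u) \<in> A" using psubset(4) by (auto dest: symD)
      have uv_arc: "u \<noteq> v" "(v, u) \<in> parcs \<Gamma>" using uv vu psubset(3) pair_no_loops by force+
      define B where "B = A - {(u, v), (v, u)}"
      have B: "B \<subset> A" "B \<subseteq> A" "sym B" using uv psubset(4) by (auto simp: B_def sym_def)
      have "\<exists>s. (\<forall>u. s u \<noteq> 0) \<and> (\<forall>(u, v)\<in>B. s u = c u v * s v)"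
        using psubset B by (intro psubset.IH) (auto dest: subset_trans)
      then obtain s where s: "\<And>u. s u \<noteq> 0" "\<And>x y. (x, y) \<in> B \<Longrightarrow> s x = c x y * s y" by blast
      have "(u, v) \<notin> B\<^sup>*"
      proof
        assume "(u, v) \<in> B\<^sup>*"
        \<comment> \<open>As a digraph, \<open>B\<close> provides a simple path from
          \<open>u\<close> to \<open>v\<close>, which the arc \<open>(v, u)\<close> closes
          up.\<close>
        let ?B = "\<lparr>pverts = pverts \<Gamma>, parcs = B\<rparr>"
        have "x \<in> pverts \<Gamma> \<and> y \<in> pverts \<Gamma>" if "(x, y) \<in> B" for x y
          using that B(2) psubset(3) in_arcsD1 in_arcsD2 by blast
        moreover have "finite B" using psubset(1) B(2) by (rule finite_subset[rotated])
        ultimately interpret B: pair_fin_digraph ?B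
          using pair_finite_verts by unfold_locales auto
        have uv_verts: "u \<in> pverts \<Gamma>" "v \<in> pverts \<Gamma>"
          using uv_arc(2) in_arcsD1 in_arcsD2 by blast+
        then have "u \<rightarrow>\<^sup>*\<^bsub>with_proj ?B\<^esub> v"
          using \<open>(u, v) \<in> B\<^sup>*\<close> uv_verts B.in_arcsD2
          unfolding reachable_def by (intro rtrancl_consistent_rtrancl_on) auto
        then obtain q where "B.awalk u q v" unfolding B.reachable_awalk by blast
        then obtain p where p: "B.apath u p v" using B.apath_awalk_to_apath by blast
        then have pB: "set p \<subseteq> B" "pcas u p v" "distinct (pawalk_verts u p)"
          by (auto simp: B.apath_def B.awalk_def)
        have "closed_reduced_path \<Gamma> ((v, u) # p)"
        proof -
          \<comment> \<open>An empty path would give \<open>u = v\<close>, and a single arc would be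
            \<open>(u, v)\<close>, which was removed.\<close>
          have "length p \<ge> 2"
          proof (rule ccontr)
            assume "\<not> length p \<ge> 2"
            then consider "p = []" | a where "p = [a]" by (cases p; cases "tl p") auto
            then show False
              using pB uv_arc(1) by cases (auto simp: B_def)
          qed
          moreover have "cycle ((v, u) # p)"
            using pB B(2) psubset(3) uv_arc uv_verts
            by (auto simp: cycle_def awalk_def intro!: exI[of _ v])
          ultimately show ?thesis by (simp add: closed_reduced_path_def)
        qed
        moreover have "set ((v, u) # p) \<subseteq> A" using vu pB(1) B(2) by auto
        ultimately show False using psubset(6) by blast
      qed
      define K where "K = {w. (v, w) \<in> B\<^sup>*}"
      have K: "x \<in> K \<longleftrightarrow> y \<in> K" if "(x, y) \<in> B" for x y
        using that B(3) by (auto simp: K_def dest: symD intro: rtrancl_into_rtrancl)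
      have "u \<notin> K" "v \<in> K"
        using \<open>(u, v) \<notin> B\<^sup>*\<close> sym_rtrancl[OF B(3)] by (auto simp: K_def dest: symD)
      \<comment> \<open>Solves \<open>s u = c u v * (r * s v)\<close>; the reverse arc then follows
        from \<open>c u v * c v u = 1\<close>.\<close>
      define r where "r = s u / (c u v * s v)"
      have c_uv: "c u v * c v u = 1" using psubset(5) uv by blast
      then have "c u v \<noteq> 0" by auto
      have "r \<noteq> 0" using s(1) \<open>c u v \<noteq> 0\<close> by (simp add: r_def)
      let ?s = "\<lambda>w. if w \<in> K then r * s w else s w"
      have "?s x = c x y * ?s y" if xy: "(x, y) \<in> A" for x y
      proof -
        consider "(x, y) \<in> B" | "x = u" "y = v" | "x = v" "y = u"
          using xy unfolding B_def by blast
        then show ?thesis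
        proof cases
          case 1
          then show ?thesis using K[OF 1] s(2)[OF 1] by simp
        next
          case 2
          then show ?thesis
            using \<open>u \<notin> K\<close> \<open>v \<in> K\<close> s(1)[of v] \<open>c u v \<noteq> 0\<close> by (simp add: r_def)
        next
          case 3
          then show ?thesis
            using \<open>u \<notin> K\<close> \<open>v \<in> K\<close> s(1)[of v] \<open>c u v \<noteq> 0\<close> c_uv by (simp add: r_def field_simps)
        qed
      qed
      then have "\<forall>(x, y)\<in>A. ?s x = c x y * ?s y" by blast
      moreover have "\<forall>w. ?s w \<noteq> 0" using s(1) \<open>r \<noteq> 0\<close> by simp
      ultimately show ?thesis by (intro exI[of _ ?s] conjI)
    qed
  qed
qed

text \<open>Each arc reverses the sign, so on a closed walk of odd length the value at the base
  point must vanish.\<close>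

lemma alternating_walk:
  fixes a :: "'v \<Rightarrow> real"
  assumes "pcas u p v" "\<forall>(x, y)\<in>set p. a x + a y = 0"
  shows "a v = (- 1) ^ length p * a u"
  using assms
proof (induction p arbitrary: u)
  case (Cons e p)
  then have "a v = (- 1) ^ length p * a (snd e)" "a (snd e) = - a u" by auto
  then show ?case by simp
qed simp

text \<open>Dead edges contain no cycle: nonzero values alternate in sign along it, so its length
  would be even, against \<open>odd\<close>. Hence \<open>forest_potential\<close> can realise a
  root of unity on each dead edge.\<close>

lemma dead_edge_rotation:
  fixes a :: "'v \<Rightarrow> real"
  assumes \<Gamma>: "pair_graph \<Gamma>"
    and even: "\<And>u v. (u, v) \<in> parcs \<Gamma> \<Longrightarrow> even (m {u, v})"
    and odd: "\<And>p. closed_reduced_path \<Gamma> p \<Longrightarrow> (\<forall>(u, v)\<in>set p. m {u, v} > (2::nat)) \<Longrightarrow> odd (length p)"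
  obtains \<theta> :: "'v \<Rightarrow> complex" where "\<And>v. \<theta> v \<noteq> 0"
    "\<And>u v. (u, v) \<in> parcs \<Gamma> \<Longrightarrow> a u \<noteq> 0 \<Longrightarrow> a u + a v = 0 \<Longrightarrow> m {u, v} > 2 \<Longrightarrow>
      (\<theta> u * \<theta> v) ^ (m {u, v} div 2) = 1 \<and> \<theta> u * \<theta> v \<noteq> 1"
proof -
  interpret pair_graph \<Gamma> by fact
  \<comment> \<open>There are \<open>n\<close> complex \<open>n\<close>-th roots of unity, so for
    \<open>n \<ge> 2\<close> one differs from 1.\<close>
  have "\<exists>\<zeta>::complex. n \<ge> 2 \<longrightarrow> \<zeta> ^ n = 1 \<and> \<zeta> \<noteq> 1" for n :: nat
  proof (rule ccontr)
    assume "\<not> ?thesis"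
    then have n: "n \<ge> 2" "{\<zeta>::complex. \<zeta> ^ n = 1} = {1}" by auto
    then show False using card_roots_unity_eq[of n] by simp
  qed
  then obtain \<zeta> :: "nat \<Rightarrow> complex" where \<zeta>: "\<And>n. n \<ge> 2 \<Longrightarrow> \<zeta> n ^ n = 1 \<and> \<zeta> n \<noteq> 1"
    by metis
  define A where "A = {(u, v) \<in> parcs \<Gamma>. a u \<noteq> 0 \<and> a u + a v = 0 \<and> m {u, v} > 2}"
  define k where "k u v = m {u, v} div 2" for u v
  have k: "k u v = k v u" for u v by (simp add: k_def insert_commute)
  \<comment> \<open>An even label above 2 is at least 4, so a root of unity other than 1 is
    available.\<close>
  have k2: "k u v \<ge> 2" if "(u, v) \<in> A" for u v
    using that even[of u v] by (auto simp: A_def k_def elim!: evenE)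
  have \<zeta>k: "\<zeta> (k u v) \<noteq> 0" if "(u, v) \<in> A" for u v
    using \<zeta>[OF k2[OF that]] k2[OF that] by (auto simp: power_0_left)
  \<comment> \<open>The ends of a dead edge have opposite signs. Inverting the unknown at negative
    vertices turns the prescribed product \<open>\<theta> u * \<theta> v\<close> into a prescribed
    ratio.\<close>
  let ?c = "\<lambda>u v. if a u > 0 then \<zeta> (k u v) else 1 / \<zeta> (k u v)"
  have "\<exists>s. (\<forall>u. s u \<noteq> 0) \<and> (\<forall>(u, v)\<in>A. s u = ?c u v * s v)"
  proof (rule forest_potential[OF \<Gamma>])
    show "A \<subseteq> parcs \<Gamma>" by (auto simp: A_def)
    show "sym A"
      using pair_sym_arcs by (auto simp: A_def sym_def symmetric_def insert_commute)
    show "?c u v * ?c v u = 1" if "(u, v) \<in> A" for u v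
      using that \<zeta>k[OF that] k[of u v] by (auto simp: A_def)
    show "\<not> set p \<subseteq> A" if p: "closed_reduced_path \<Gamma> p" for p
    proof
      assume A: "set p \<subseteq> A"
      then have "odd (length p)" by (intro odd[OF p]) (auto simp: A_def)
      obtain u where u: "pcas u p u" "p \<noteq> []"
        using p by (auto simp: closed_reduced_path_def cycle_def awalk_def)
      have "a u = (- 1) ^ length p * a u"
        using A by (intro alternating_walk[OF u(1)]) (auto simp: A_def)
      then have "a u = 0" using \<open>odd (length p)\<close> by simp
      moreover obtain v q where "p = (u, v) # q" using u by (cases p) auto
      ultimately show False using A by (auto simp: A_def)
    qed
  qed
  then obtain s where s: "\<And>u. s u \<noteq> 0" "\<And>u v. (u, v) \<in> A \<Longrightarrow> s u = ?c u v * s v" by blast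
  define \<theta> where "\<theta> u = (if a u > 0 then s u else 1 / s u)" for u
  have "\<theta> u * \<theta> v = \<zeta> (k u v)" if "(u, v) \<in> A" for u v
  proof (cases "a u > 0")
    case True
    then have "\<not> a v > 0" using that by (auto simp: A_def)
    then show ?thesis using s(1)[of v] s(2)[OF that] True by (simp add: \<theta>_def)
  next
    case False
    then have "a v > 0" using that by (auto simp: A_def)
    then show ?thesis using s(1)[of v] s(2)[OF that] \<zeta>k[OF that] False by (simp add: \<theta>_def)
  qed
  then show thesis
    using \<zeta> k2 s(1) by (intro that[of \<theta>]) (auto simp: \<theta>_def A_def k_def)
qed

section \<open>Even Artin groups\<close>

locale even_artin =
  fixes \<Gamma> :: "'v pair_pre_digraph" and m :: "'v set \<Rightarrow> nat"
  assumes graph: "pair_graph \<Gamma>"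
    and label: "(u, v) \<in> parcs \<Gamma> \<Longrightarrow> m {u, v} \<ge> 2 \<and> even (m {u, v})"
begin

sublocale pair_graph \<Gamma> by (rule graph)

definition relations :: "('v word \<times> 'v word) set" where
  "relations = {(alt_word u v (m {u, v}), alt_word v u (m {u, v})) | u v. (u, v) \<in> parcs \<Gamma>}"

abbreviation "A\<^sub>\<Gamma> \<equiv> artin_group \<Gamma> m"

abbreviation "gen \<equiv> generator (pverts \<Gamma>) relations"

lemma artin_group_presented: "A\<^sub>\<Gamma> = presented_group (pverts \<Gamma>) relations"
  by (simp add: artin_group_def relations_def)

lemma relations_words: "relations \<subseteq> words (pverts \<Gamma>) \<times> words (pverts \<Gamma>)"
  by (auto simp: relations_def alt_word_def words_def in_arcsD1 in_arcsD2)

sublocale group A\<^sub>\<Gamma>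
  by (rule group_artin_group[OF graph])

lemma gen_closed [simp]: "v \<in> pverts \<Gamma> \<Longrightarrow> gen v \<in> carrier A\<^sub>\<Gamma>"
  by (simp add: artin_group_presented)

lemma generate_gen: "generate A\<^sub>\<Gamma> (gen ` pverts \<Gamma>) = carrier A\<^sub>\<Gamma>"
  unfolding artin_group_presented by (rule generate_generator[OF relations_words])

lemma gen_relation:
  assumes "(u, v) \<in> parcs \<Gamma>"
  shows "(gen u \<otimes>\<^bsub>A\<^sub>\<Gamma>\<^esub> gen v) [^]\<^bsub>A\<^sub>\<Gamma>\<^esub> (m {u, v} div 2) = (gen v \<otimes>\<^bsub>A\<^sub>\<Gamma>\<^esub> gen u) [^]\<^bsub>A\<^sub>\<Gamma>\<^esub> (m {u, v} div 2)"
proof -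
  have uv: "u \<in> pverts \<Gamma>" "v \<in> pverts \<Gamma>" using assms in_arcsD1 in_arcsD2 by auto
  have m: "m {u, v} = 2 * (m {u, v} div 2)" using label[OF assms] by simp
  have rel: "(alt_word u v (m {u, v}), alt_word v u (m {u, v})) \<in> relations"
    using assms by (auto simp: relations_def)
  have "pres_eq (pverts \<Gamma>) relations (alt_word u v (m {u, v})) (alt_word v u (m {u, v}))"
    using pres_eq.rel[OF words_Nil words_Nil rel] by simp
  then have "word_value A\<^sub>\<Gamma> gen (alt_word u v (m {u, v})) = word_value A\<^sub>\<Gamma> gen (alt_word v u (m {u, v}))"
    using pres_class_eq[OF relations_words] rel relations_words
    by (auto simp: artin_group_presented word_value_generator[OF relations_words] simp del: Image_singleton_iff)
  then show ?thesis
    using word_value_alt_word[of gen u v "m {u, v} div 2"] word_value_alt_word[of gen v u "m {u, v} div 2"]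
      uv m by simp
qed

lemma artin_group_hom:
  assumes "group H" and \<phi>: "\<And>v. v \<in> pverts \<Gamma> \<Longrightarrow> \<phi> v \<in> carrier H"
    and rel: "\<And>u v. (u, v) \<in> parcs \<Gamma> \<Longrightarrow>
      (\<phi> u \<otimes>\<^bsub>H\<^esub> \<phi> v) [^]\<^bsub>H\<^esub> (m {u, v} div 2) = (\<phi> v \<otimes>\<^bsub>H\<^esub> \<phi> u) [^]\<^bsub>H\<^esub> (m {u, v} div 2)"
  obtains \<rho> where "\<rho> \<in> hom A\<^sub>\<Gamma> H" "\<And>v. v \<in> pverts \<Gamma> \<Longrightarrow> \<rho> (gen v) = \<phi> v"
proof -
  interpret H: group H by fact
  have "word_value H \<phi> r = word_value H \<phi> s" if "(r, s) \<in> relations" for r s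
  proof -
    from that obtain u v where uv: "(u, v) \<in> parcs \<Gamma>"
        "r = alt_word u v (m {u, v})" "s = alt_word v u (m {u, v})"
      by (auto simp: relations_def)
    have m: "m {u, v} = 2 * (m {u, v} div 2)" using label[OF uv(1)] by simp
    show ?thesis
      using uv rel[OF uv(1)] \<phi>[of u] \<phi>[of v] in_arcsD1[OF uv(1)] in_arcsD2[OF uv(1)] m
        H.word_value_alt_word[of \<phi> u v "m {u, v} div 2"] H.word_value_alt_word[of \<phi> v u "m {u, v} div 2"]
      by simp
  qed
  then obtain \<rho> where "\<rho> \<in> hom A\<^sub>\<Gamma> H"
      "\<And>w. w \<in> words (pverts \<Gamma>) \<Longrightarrow> \<rho> (pres_rel (pverts \<Gamma>) relations `` {w}) = word_value H \<phi> w"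
    using presented_group_hom[OF assms(1) relations_words, of \<phi>] \<phi> unfolding artin_group_presented by blast
  then show thesis
    using \<phi> by (intro that[of \<rho>]) (simp_all add: generator_def del: Image_singleton_iff)
qed

section \<open>The criterion on live vertices\<close>

definition live_arcs :: "('v word set \<Rightarrow> real) \<Rightarrow> ('v \<times> 'v) set" where
  "live_arcs \<chi> = {(u, v) \<in> parcs \<Gamma>. \<chi> (gen u) \<noteq> 0 \<and> \<chi> (gen v) \<noteq> 0 \<and>
     (m {u, v} = 2 \<or> \<chi> (gen u) + \<chi> (gen v) \<noteq> 0)}"

text \<open>For label \<open>2 n\<close>, \<open>(u v)^n\<close> commutes with both ends and its
  value is \<open>n\<close> times the sum of theirs. If the sum is 0, the label is 2 and
  \<open>u\<close> is the bridge. One end may have value 0, which covers dominated vertices.\<close>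

lemma bridged_arc:
  assumes "character A\<^sub>\<Gamma> \<chi>" and uv: "(u, v) \<in> parcs \<Gamma>"
    and "\<chi> (gen u) + \<chi> (gen v) \<noteq> 0 \<or> m {u, v} = 2 \<and> \<chi> (gen u) \<noteq> 0"
  shows "character.bridged A\<^sub>\<Gamma> \<chi> (gen u) (gen v)"
proof -
  interpret character "A\<^sub>\<Gamma>" \<chi> by fact
  let ?u = "gen u" and ?v = "gen v" and ?n = "m {u, v} div 2"
  have car: "?u \<in> carrier A\<^sub>\<Gamma>" "?v \<in> carrier A\<^sub>\<Gamma>" using in_arcsD1[OF uv] in_arcsD2[OF uv] by auto
  note rel = gen_relation[OF uv]
  show ?thesis
  proof (cases "\<chi> ?u + \<chi> ?v = 0")
    case True
    then have "m {u, v} = 2" "\<chi> ?u \<noteq> 0" using assms(3) by auto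
    then have "?u \<otimes>\<^bsub>A\<^sub>\<Gamma>\<^esub> ?v = ?v \<otimes>\<^bsub>A\<^sub>\<Gamma>\<^esub> ?u" using rel car by simp
    then show ?thesis
      unfolding bridged_def using car(1) \<open>\<chi> ?u \<noteq> 0\<close> by (intro bexI[of _ ?u] conjI) simp_all
  next
    case False
    have "?n \<noteq> 0" using label[OF uv] by auto
    then have "\<chi> ((?u \<otimes>\<^bsub>A\<^sub>\<Gamma>\<^esub> ?v) [^]\<^bsub>A\<^sub>\<Gamma>\<^esub> ?n) \<noteq> 0" using False car by simp
    then show ?thesis
      unfolding bridged_def using power_product_commute[OF car rel] car
      by (intro bexI[of _ "(?u \<otimes>\<^bsub>A\<^sub>\<Gamma>\<^esub> ?v) [^]\<^bsub>A\<^sub>\<Gamma>\<^esub> ?n"] conjI) simp_all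
  qed
qed

lemma nonzero_on_generator:
  assumes "\<chi> \<in> nonzero_characters A\<^sub>\<Gamma>"
  shows "\<exists>v\<in>pverts \<Gamma>. \<chi> (gen v) \<noteq> 0"
proof (rule ccontr)
  assume "\<not> ?thesis"
  then have zero: "\<chi> (gen v) = 0" if "v \<in> pverts \<Gamma>" for v using that by blast
  interpret character "A\<^sub>\<Gamma>" \<chi>
    using assms by unfold_locales (simp add: nonzero_characters_def)
  have "\<chi> g = 0" if "g \<in> generate A\<^sub>\<Gamma> (gen ` pverts \<Gamma>)" for g
    using that
  proof induction
    case (eng g h)
    then have "g \<in> carrier A\<^sub>\<Gamma>" "h \<in> carrier A\<^sub>\<Gamma>" by (simp_all add: generate_gen)
    then show ?case using eng by simp
  qed (use zero in auto)
  then show False using assms by (auto simp: nonzero_characters_def generate_gen)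
qed

text \<open>Live arcs and edges from other vertices to live ones are bridges, so
  \<open>linked_if_bridged\<close> applies to the standard generators.\<close>

lemma Sigma1_if_live_connected_dominating:
  assumes \<chi>: "\<chi> \<in> nonzero_characters A\<^sub>\<Gamma>"
    and conn: "\<And>u v. u \<in> pverts \<Gamma> \<Longrightarrow> v \<in> pverts \<Gamma> \<Longrightarrow> \<chi> (gen u) \<noteq> 0 \<Longrightarrow> \<chi> (gen v) \<noteq> 0 \<Longrightarrow>
      (u, v) \<in> (live_arcs \<chi>)\<^sup>*"
    and dom: "\<And>w. w \<in> pverts \<Gamma> \<Longrightarrow> \<chi> (gen w) = 0 \<Longrightarrow> \<exists>v. (w, v) \<in> parcs \<Gamma> \<and> \<chi> (gen v) \<noteq> 0"
  shows "character_class A\<^sub>\<Gamma> \<chi> \<in> Sigma1 A\<^sub>\<Gamma>"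
proof -
  interpret character "A\<^sub>\<Gamma>" \<chi>
    using \<chi> by unfold_locales (simp add: nonzero_characters_def)
  note bridge = bridged_arc[OF character_axioms]
  let ?Y = "gen ` pverts \<Gamma>"
  let ?E = "{(x, y). x \<in> ?Y \<and> y \<in> ?Y \<and> \<chi> x \<noteq> 0 \<and> \<chi> y \<noteq> 0 \<and> bridged x y}"
  have path: "(gen u, gen v) \<in> ?E\<^sup>*" if "(u, v) \<in> (live_arcs \<chi>)\<^sup>*" for u v
    using that
  proof induction
    case (step v w)
    have "(gen v, gen w) \<in> ?E"
      using step(2) bridge[of v w] in_arcsD1[of v w] in_arcsD2[of v w] by (auto simp: live_arcs_def)
    with step(3) show ?case by (rule rtrancl_into_rtrancl)
  qed simp
  have dominating: "\<exists>y\<in>?Y. \<chi> y \<noteq> 0 \<and> bridged x y" if x: "x \<in> ?Y" "\<chi> x = 0" for x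
  proof -
    obtain w where w: "w \<in> pverts \<Gamma>" "x = gen w" using x(1) by auto
    then obtain v where v: "(w, v) \<in> parcs \<Gamma>" "\<chi> (gen v) \<noteq> 0" using dom x(2) by blast
    then show ?thesis using bridge[of w v] w x(2) in_arcsD2[OF v(1)] by auto
  qed
  have "?Y \<subseteq> carrier A\<^sub>\<Gamma>" by auto
  moreover have "\<exists>x\<in>?Y. \<chi> x \<noteq> 0" using nonzero_on_generator[OF \<chi>] by blast
  moreover have "(x, y) \<in> ?E\<^sup>*" if "x \<in> ?Y" "y \<in> ?Y" "\<chi> x \<noteq> 0" "\<chi> y \<noteq> 0" for x y
    using that path conn by blast
  ultimately have "linked A\<^sub>\<Gamma> \<chi> ?Y 0 \<one>\<^bsub>A\<^sub>\<Gamma>\<^esub> g" if "g \<in> carrier A\<^sub>\<Gamma>" "\<chi> g \<ge> 0" for g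
    using that dominating by (intro linked_if_bridged[OF _ generate_gen]) 
  then show ?thesis
    unfolding character_class_in_Sigma1_iff[OF is_group \<chi>]
    using generate_gen pair_finite_verts by (intro exI[of _ ?Y]) auto
qed

text \<open>Reduces the obstruction to data on vertices and edges: commuting images satisfy the
  relation for every label, and first components agreeing with \<open>\<chi>\<close> on generators
  agree everywhere.\<close>

lemma not_Sigma1_if_representation:
  assumes \<chi>: "\<chi> \<in> nonzero_characters A\<^sub>\<Gamma>"
    and \<phi>: "\<And>v. v \<in> pverts \<Gamma> \<Longrightarrow> \<phi> v \<in> carrier shift_affine_group"
      "\<And>v. v \<in> pverts \<Gamma> \<Longrightarrow> fst (\<phi> v) = \<chi> (gen v)"
    and rel: "\<And>u v. (u, v) \<in> parcs \<Gamma> \<Longrightarrow>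
      \<phi> u \<otimes>\<^bsub>shift_affine_group\<^esub> \<phi> v = \<phi> v \<otimes>\<^bsub>shift_affine_group\<^esub> \<phi> u \<or>
      (\<phi> u \<otimes>\<^bsub>shift_affine_group\<^esub> \<phi> v) [^]\<^bsub>shift_affine_group\<^esub> (m {u, v} div 2) =
      (\<phi> v \<otimes>\<^bsub>shift_affine_group\<^esub> \<phi> u) [^]\<^bsub>shift_affine_group\<^esub> (m {u, v} div 2)"
    and ab: "a \<in> pverts \<Gamma>" "b \<in> pverts \<Gamma>"
      "\<phi> a \<otimes>\<^bsub>shift_affine_group\<^esub> \<phi> b \<noteq> \<phi> b \<otimes>\<^bsub>shift_affine_group\<^esub> \<phi> a"
  shows "character_class (A\<^sub>\<Gamma> Mod second_derived A\<^sub>\<Gamma>) (induced_map \<chi>) \<notin> Sigma1 (A\<^sub>\<Gamma> Mod second_derived A\<^sub>\<Gamma>)"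
proof -
  let ?A = shift_affine_group
  have "(\<phi> u \<otimes>\<^bsub>?A\<^esub> \<phi> v) [^]\<^bsub>?A\<^esub> (m {u, v} div 2) = (\<phi> v \<otimes>\<^bsub>?A\<^esub> \<phi> u) [^]\<^bsub>?A\<^esub> (m {u, v} div 2)"
    if "(u, v) \<in> parcs \<Gamma>" for u v
    using rel[OF that] by (elim disjE) simp_all
  from artin_group_hom[OF group_shift_affine_group \<phi>(1) this]
  obtain \<rho> where \<rho>: "\<rho> \<in> hom A\<^sub>\<Gamma> ?A" "\<And>v. v \<in> pverts \<Gamma> \<Longrightarrow> \<rho> (gen v) = \<phi> v"
    by blast
  interpret \<rho>: group_hom "A\<^sub>\<Gamma>" ?A \<rho>
    using \<rho>(1) group_shift_affine_group is_group by (simp add: group_hom_def group_hom_axioms_def)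
  have "(\<lambda>g. fst (\<rho> g)) \<in> hom A\<^sub>\<Gamma> real_group"
  proof (rule homI)
    fix g h assume "g \<in> carrier A\<^sub>\<Gamma>" "h \<in> carrier A\<^sub>\<Gamma>"
    then show "fst (\<rho> (g \<otimes>\<^bsub>A\<^sub>\<Gamma>\<^esub> h)) = fst (\<rho> g) \<otimes>\<^bsub>real_group\<^esub> fst (\<rho> h)"
      by (cases "\<rho> g"; cases "\<rho> h") (simp add: real_group_def)
  qed (simp add: real_group_def)
  moreover have "\<chi> \<in> hom A\<^sub>\<Gamma> real_group" using \<chi> by (simp add: nonzero_characters_def)
  ultimately have "fst (\<rho> g) = \<chi> g" if "g \<in> carrier A\<^sub>\<Gamma>" for g
  proof (rule hom_eq_on_generate[OF group_real_group, where Y = "gen ` pverts \<Gamma>"])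
    show "gen ` pverts \<Gamma> \<subseteq> carrier A\<^sub>\<Gamma>" by (rule image_subsetI) simp
    show "g \<in> generate A\<^sub>\<Gamma> (gen ` pverts \<Gamma>)" using that unfolding generate_gen .
    show "fst (\<rho> y) = \<chi> y" if "y \<in> gen ` pverts \<Gamma>" for y
      using that \<rho>(2) \<phi>(2) by auto
  qed
  moreover have "\<rho> (gen a \<otimes>\<^bsub>A\<^sub>\<Gamma>\<^esub> gen b) \<noteq> \<rho> (gen b \<otimes>\<^bsub>A\<^sub>\<Gamma>\<^esub> gen a)"
    using ab \<rho>(2) by simp
  ultimately show ?thesis
    using ab(1,2) by (intro not_Sigma1_second_derived_quotient[OF is_group \<chi> \<rho>(1), of "gen a" "gen b"]) auto
qed

text \<open>Only \<open>w\<close> has a translation part, a unit mass at 0; the other vertices act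
  by shifts. Neighbours of \<open>w\<close> act trivially, while a live \<open>t\<close> moves the
  mass and so does not commute with \<open>w\<close>.\<close>

lemma not_Sigma1_if_not_dominating:
  assumes \<chi>: "\<chi> \<in> nonzero_characters A\<^sub>\<Gamma>"
    and w: "w \<in> pverts \<Gamma>" "\<chi> (gen w) = 0" "\<And>v. (w, v) \<in> parcs \<Gamma> \<Longrightarrow> \<chi> (gen v) = 0"
  shows "character_class (A\<^sub>\<Gamma> Mod second_derived A\<^sub>\<Gamma>) (induced_map \<chi>) \<notin> Sigma1 (A\<^sub>\<Gamma> Mod second_derived A\<^sub>\<Gamma>)"
proof -
  define f :: "'v \<Rightarrow> real \<Rightarrow> complex" where "f v = (\<lambda>x. if v = w \<and> x = 0 then 1 else 0)" for v
  obtain t where t: "t \<in> pverts \<Gamma>" "\<chi> (gen t) \<noteq> 0" using nonzero_on_generator[OF \<chi>] by blast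
  have w': "\<chi> (gen v) = 0" if "(v, w) \<in> parcs \<Gamma>" for v
    using that w(3) pair_sym_arcs by (auto simp: symmetric_def dest: symD)
  show ?thesis
  proof (rule not_Sigma1_if_representation[OF \<chi>, of "\<lambda>v. (\<chi> (gen v), 1, f v)" w t])
    show "(\<chi> (gen v), 1, f v) \<in> carrier shift_affine_group" for v
      by (auto simp: f_def intro!: exI[of _ "0::real"])
    have "f t = (\<lambda>x. 0)" "f w 0 = 1" "f w (0 - \<chi> (gen t)) = 0" using t w(2) by (auto simp: f_def)
    then show "(\<chi> (gen w), 1, f w) \<otimes>\<^bsub>shift_affine_group\<^esub> (\<chi> (gen t), 1, f t) \<noteq>
        (\<chi> (gen t), 1, f t) \<otimes>\<^bsub>shift_affine_group\<^esub> (\<chi> (gen w), 1, f w)"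
      by (auto simp: fun_eq_iff intro!: exI[of _ "0::real"])
  next
    fix u v assume uv: "(u, v) \<in> parcs \<Gamma>"
    show "(\<chi> (gen u), 1, f u) \<otimes>\<^bsub>shift_affine_group\<^esub> (\<chi> (gen v), 1, f v) =
        (\<chi> (gen v), 1, f v) \<otimes>\<^bsub>shift_affine_group\<^esub> (\<chi> (gen u), 1, f u) \<or>
      ((\<chi> (gen u), 1, f u) \<otimes>\<^bsub>shift_affine_group\<^esub> (\<chi> (gen v), 1, f v)) [^]\<^bsub>shift_affine_group\<^esub> (m {u, v} div 2) =
      ((\<chi> (gen v), 1, f v) \<otimes>\<^bsub>shift_affine_group\<^esub> (\<chi> (gen u), 1, f u)) [^]\<^bsub>shift_affine_group\<^esub> (m {u, v} div 2)"
      using uv w(2) w(3)[of v] w'[of u] by (intro disjI1) (auto simp: f_def fun_eq_iff)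
  qed (use w t in auto)
qed

text \<open>Vertices in the live component \<open>L\<close> of \<open>p\<close> fix
  \<open>- \<delta>\<close>, all others fix 0, and maps with a common fixed point commute. An edge
  leaving \<open>L\<close> ends in a vertex acting trivially or is dead, and then the product of its
  ends is torsion.\<close>

lemma not_Sigma1_if_not_live_connected:
  assumes odd: "\<And>p. closed_reduced_path \<Gamma> p \<Longrightarrow> (\<forall>(u, v)\<in>set p. m {u, v} > 2) \<Longrightarrow> odd (length p)"
    and \<chi>: "\<chi> \<in> nonzero_characters A\<^sub>\<Gamma>"
    and p: "p \<in> pverts \<Gamma>" "\<chi> (gen p) \<noteq> 0" and q: "q \<in> pverts \<Gamma>" "\<chi> (gen q) \<noteq> 0"
    and pq: "(p, q) \<notin> (live_arcs \<chi>)\<^sup>*"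
  shows "character_class (A\<^sub>\<Gamma> Mod second_derived A\<^sub>\<Gamma>) (induced_map \<chi>) \<notin> Sigma1 (A\<^sub>\<Gamma> Mod second_derived A\<^sub>\<Gamma>)"
proof -
  let ?a = "\<lambda>v. \<chi> (gen v)"
  obtain \<theta> :: "'v \<Rightarrow> complex" where \<theta>: "\<And>v. \<theta> v \<noteq> 0"
      "\<And>u v. (u, v) \<in> parcs \<Gamma> \<Longrightarrow> ?a u \<noteq> 0 \<Longrightarrow> ?a u + ?a v = 0 \<Longrightarrow> m {u, v} > 2 \<Longrightarrow>
        (\<theta> u * \<theta> v) ^ (m {u, v} div 2) = 1 \<and> \<theta> u * \<theta> v \<noteq> 1"
    using dead_edge_rotation[of \<Gamma> m ?a] graph label odd by blast
  define L where "L = {v. (p, v) \<in> (live_arcs \<chi>)\<^sup>*}"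
  define \<delta> :: "real \<Rightarrow> complex" where "\<delta> x = (if x = 0 then 1 else 0)" for x
  \<comment> \<open>The value 1 makes a vertex with \<open>?a v = 0\<close> outside \<open>L\<close>
    act as the identity.\<close>
  define \<tau> where "\<tau> v = (if ?a v = 0 then 1 else \<theta> v)" for v
  \<comment> \<open>For \<open>v \<in> L\<close> with linear part \<open>T\<close> this is
    \<open>T \<delta> - \<delta>\<close>, so the map \<open>x \<mapsto> f v + T x\<close> fixes
    \<open>- \<delta>\<close>.\<close>
  define f where "f v = (\<lambda>x. if v \<in> L then \<tau> v * \<delta> (x - ?a v) - \<delta> x else 0)" for v
  let ?\<phi> = "\<lambda>v. (?a v, \<tau> v, f v)" and ?A = shift_affine_group
  have \<tau>: "\<tau> v \<noteq> 0" for v using \<theta>(1) by (simp add: \<tau>_def)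
  have L: "p \<in> L" "q \<notin> L" using pq by (auto simp: L_def)
  \<comment> \<open>\<open>L\<close> is closed under live arcs and consists of live
    vertices.\<close>
  have crossing: "?a v = 0 \<or> ?a u \<noteq> 0 \<and> ?a u + ?a v = 0 \<and> m {u, v} > 2"
    if uv: "(u, v) \<in> parcs \<Gamma>" "u \<in> L" "v \<notin> L" for u v
  proof -
    have "(p, u) \<in> (live_arcs \<chi>)\<^sup>*" using uv(2) by (simp add: L_def)
    then have "?a u \<noteq> 0" by (cases rule: rtranclE) (use p(2) in \<open>auto simp: live_arcs_def\<close>)
    moreover have "(u, v) \<notin> live_arcs \<chi>"
      using uv by (auto simp: L_def intro: rtrancl_into_rtrancl)
    ultimately show ?thesis
      using uv(1) label[OF uv(1)] by (auto simp: live_arcs_def)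
  qed
  have dead: "(?\<phi> u \<otimes>\<^bsub>?A\<^esub> ?\<phi> v) [^]\<^bsub>?A\<^esub> (m {u, v} div 2) = (0, 1, \<lambda>x. 0)"
    if uv: "(u, v) \<in> parcs \<Gamma>" "?a u \<noteq> 0" "?a u + ?a v = 0" "m {u, v} > 2" for u v
  proof -
    have "?a v \<noteq> 0" using uv by auto
    then show ?thesis using \<theta>(2)[OF uv] uv(2,3) by (simp add: \<tau>_def shift_affine_torsion)
  qed
  show ?thesis
  proof (rule not_Sigma1_if_representation[OF \<chi>, of ?\<phi> p q])
    show "?\<phi> v \<in> carrier ?A" for v
      using \<tau> by (auto simp: f_def \<delta>_def intro!: exI[of _ "min 0 (?a v)"])
    show "?\<phi> p \<otimes>\<^bsub>?A\<^esub> ?\<phi> q \<noteq> ?\<phi> q \<otimes>\<^bsub>?A\<^esub> ?\<phi> p"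
    proof
      assume "?\<phi> p \<otimes>\<^bsub>?A\<^esub> ?\<phi> q = ?\<phi> q \<otimes>\<^bsub>?A\<^esub> ?\<phi> p"
      then have "(\<lambda>x. f p x + \<tau> p * f q (x - ?a p)) = (\<lambda>x. f q x + \<tau> q * f p (x - ?a q))"
        by simp
      moreover have "f q x = 0" for x using L by (simp add: f_def)
      ultimately have eq: "f p x = \<tau> q * f p (x - ?a q)" for x
        by (metis add_0 add_0_right mult_zero_right)
      \<comment> \<open>The evaluation point makes the right side of \<open>eq\<close> vanish but
        not the left: at \<open>?a p\<close> the left is \<open>\<tau> p\<close>, at 0 it is
        -1.\<close>
      show False
      proof (cases "?a p + ?a q = 0")
        case True
        then have "?a p - ?a q = 2 * ?a p" by simp
        then show False
          using eq[of "?a p"] p(2) L(1) \<tau>[of p] by (simp add: f_def \<delta>_def)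
      next
        case False
        then have "- ?a q - ?a p \<noteq> 0" by linarith
        then show False
          using eq[of 0] p(2) q(2) L(1) by (simp add: f_def \<delta>_def)
      qed
    qed
  next
    fix u v assume uv: "(u, v) \<in> parcs \<Gamma>"
    have vu: "(v, u) \<in> parcs \<Gamma>" using uv pair_sym_arcs by (auto simp: symmetric_def dest: symD)
    consider "u \<in> L \<longleftrightarrow> v \<in> L" | "u \<in> L" "v \<notin> L" | "v \<in> L" "u \<notin> L" by blast
    then show "?\<phi> u \<otimes>\<^bsub>?A\<^esub> ?\<phi> v = ?\<phi> v \<otimes>\<^bsub>?A\<^esub> ?\<phi> u \<or>
      (?\<phi> u \<otimes>\<^bsub>?A\<^esub> ?\<phi> v) [^]\<^bsub>?A\<^esub> (m {u, v} div 2) = (?\<phi> v \<otimes>\<^bsub>?A\<^esub> ?\<phi> u) [^]\<^bsub>?A\<^esub> (m {u, v} div 2)"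
    proof cases
      case 1
      then show ?thesis
        by (intro disjI1) (auto simp: f_def fun_eq_iff algebra_simps)
    next
      case 2
      from crossing[OF uv 2] show ?thesis
      proof
        assume "?a v = 0"
        then show ?thesis using 2 by (intro disjI1) (simp add: f_def \<tau>_def fun_eq_iff)
      next
        assume d: "?a u \<noteq> 0 \<and> ?a u + ?a v = 0 \<and> m {u, v} > 2"
        then have "?a v \<noteq> 0 \<and> ?a v + ?a u = 0 \<and> m {v, u} > 2" by (auto simp: insert_commute)
        then show ?thesis using dead[OF uv] dead[OF vu] d by (simp add: insert_commute)
      qed
    next
      case 3
      from crossing[OF vu 3] show ?thesis
      proof
        assume "?a u = 0"
        then show ?thesis using 3 by (intro disjI1) (simp add: f_def \<tau>_def fun_eq_iff)
      next
        assume d: "?a v \<noteq> 0 \<and> ?a v + ?a u = 0 \<and> m {v, u} > 2"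
        then have "?a u \<noteq> 0 \<and> ?a u + ?a v = 0 \<and> m {u, v} > 2" by (auto simp: insert_commute)
        then show ?thesis using dead[OF uv] dead[OF vu] d by (simp add: insert_commute)
      qed
    qed
  qed (use p q in auto)
qed

end

theorem corollaryC:
  fixes \<Gamma> :: "'v pair_pre_digraph" and m :: "'v set \<Rightarrow> nat"
  assumes "pair_graph \<Gamma>"
    and "\<And>u v. (u, v) \<in> parcs \<Gamma> \<Longrightarrow> m {u, v} \<ge> 2 \<and> even (m {u, v})"
    and "\<And>p. closed_reduced_path \<Gamma> p \<Longrightarrow> (\<forall>(u, v)\<in>set p. m {u, v} > 2) \<Longrightarrow> odd (length p)"
  shows "let G = artin_group \<Gamma> m; Q = G Mod second_derived G in
    \<forall>\<chi>\<in>nonzero_characters G.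
      character_class G \<chi> \<in> Sigma1 G \<longleftrightarrow> character_class Q (induced_map \<chi>) \<in> Sigma1 Q"
proof -
  interpret even_artin \<Gamma> m using assms(1,2) by (rule even_artin.intro)
  let ?Q = "A\<^sub>\<Gamma> Mod second_derived A\<^sub>\<Gamma>"
  show ?thesis
    unfolding Let_def
  proof (intro ballI iffI)
    fix \<chi> assume \<chi>: "\<chi> \<in> nonzero_characters A\<^sub>\<Gamma>"
    show "character_class ?Q (induced_map \<chi>) \<in> Sigma1 ?Q" if "character_class A\<^sub>\<Gamma> \<chi> \<in> Sigma1 A\<^sub>\<Gamma>"
      by (rule Sigma1_second_derived_quotient[OF is_group \<chi> that])
    \<comment> \<open>By contraposition: if the criterion fails, one of the two affine
      representations keeps the induced class out of \<open>Sigma1 ?Q\<close>.\<close>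
    show "character_class A\<^sub>\<Gamma> \<chi> \<in> Sigma1 A\<^sub>\<Gamma>" if "character_class ?Q (induced_map \<chi>) \<in> Sigma1 ?Q"
      using that not_Sigma1_if_not_live_connected[OF assms(3) \<chi>] not_Sigma1_if_not_dominating[OF \<chi>]
      by (intro Sigma1_if_live_connected_dominating[OF \<chi>]) blast+
  qed
qed

end
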